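(* For any $m\ge2$, the algorithm ALG($5/3$) (the algorithm ALG($c$) of the context with $c=5/3$) is $5/3$-competitive and uses at most $4m$ job migrations on every job sequence.
   Context: Problem: jobs $J_1,\dots,J_n$ with processing times $p_i>0$ arrive online and must be assigned non-preemptively and immediately to one of $m$ identical machines $M_1,\dots,M_m$; a migration removes an assigned job and reassigns it. Makespan = maximum machine load in the final schedule; an algorithm is $c$-competitive if its makespan is at most $c$ times the optimum offline makespan on every sequence. Notation: $p_t^+=\sum_{i\le t}p_i$; $p_t^i$ = $i$-th largest processing time among $J_1,\dots,J_t$ ($0$ if $i>t$). $L_t=\max\{p_t^+/m,\ p_t^1,\ 2p_t^{m+1}\}$. Job $J_i$, $i\le t$, is small at time $t$ if $p_i\le(2c-3)L_t$; $J_t$ is small if small at time $t$, large otherwise. $\ell(j,t)$ = load of $M_j$ just before $J_t$ is assigned; $\ell_s(j,t)$ = same load counting only jobs small at time $t$. $A=\{M_1,\dots,M_{\lfloor m/2\rfloor}\}$, $B=\{M_{\lfloor m/2\rfloor+1},\dots,M_m\}$. Algorithm ALG($c$). Arrival phase: if $J_t$ is small, let $A'=\{M_j\in A:\ell_s(j,t)\le(c-1)L_t\}$; if $A'\ne\emptyset$ assign $J_t$ to a machine of $A'$ with smallest $\ell_s(j,t)$, otherwise to a least loaded machine of $B$. If $J_t$ is large: if some $M_j\in A$ has $\ell(j,t)\le(3-c)L_t$, assign $J_t$ to a least loaded machine of $A$, otherwise to a least loaded machine of $B$. Let $L=L_n$. Migration phase ($\ell(j)$ = current load): removal: $R=\emptyset$;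 from every machine of $B$ remove its largest job into $R$; while some $M_j\in A$ has $\ell(j)>(c-1)L$, remove its largest job into $R$. Reassignment: sort $R$ by non-increasing processing time; for each job $J$ in this order, if some $M_j\in B$ has $\ell(j)+p(J)\le cL$ assign $J$ there, otherwise to a least loaded machine of $A$. Each job of $R$ counts as one migration. *)

theory Defs
  imports Complex_Main
begin

text \<open>
  Jobs are the numbers \<open>1..n\<close> and machines the numbers \<open>1..m\<close>; job \<open>i\<close> has processing time \<open>p i\<close>.
  A (partial) schedule maps every job that is currently assigned to its machine.
\<close>

type_synonym schedule = "nat \<Rightarrow> nat option"

definition load :: "(nat \<Rightarrow> real) \<Rightarrow> schedule \<Rightarrow> nat \<Rightarrow> real" where
  "load p \<sigma> j = (\<Sum>i | \<sigma> i = Some j. p i)"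

definition makespan :: "nat \<Rightarrow> (nat \<Rightarrow> real) \<Rightarrow> schedule \<Rightarrow> real" where
  "makespan m p \<sigma> = Max (load p \<sigma> ` {1..m})"

definition schedules :: "nat \<Rightarrow> nat \<Rightarrow> schedule set" where
  "schedules m n = {\<sigma>. dom \<sigma> = {1..n} \<and> ran \<sigma> \<subseteq> {1..m}}"

definition opt :: "nat \<Rightarrow> (nat \<Rightarrow> real) \<Rightarrow> nat \<Rightarrow> real" where
  "opt m p n = Min (makespan m p ` schedules m n)"

text \<open>
  An algorithm is given as the relation between an input (processing times and number of jobs) and
  the outcomes (final schedule and set of migrated jobs) of its possible runs. There may be several
  outcomes because ties can be broken arbitrarily; guarantees are demanded of every run.
\<close>

type_synonym algorithm = "(nat \<Rightarrow> real) \<Rightarrow> nat \<Rightarrow> schedule \<Rightarrow> nat set \<Rightarrow> bool"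

definition competitive :: "nat \<Rightarrow> real \<Rightarrow> algorithm \<Rightarrow> bool" where
  "competitive m c Alg \<longleftrightarrow>
     (\<forall>p n \<sigma> R. (\<forall>i\<in>{1..n}. 0 < p i) \<longrightarrow> Alg p n \<sigma> R \<longrightarrow> makespan m p \<sigma> \<le> c * opt m p n)"

definition migrations_at_most :: "nat \<Rightarrow> algorithm \<Rightarrow> bool" where
  "migrations_at_most k Alg \<longleftrightarrow>
     (\<forall>p n \<sigma> R. (\<forall>i\<in>{1..n}. 0 < p i) \<longrightarrow> Alg p n \<sigma> R \<longrightarrow> card R \<le> k)"

definition kth_largest :: "(nat \<Rightarrow> real) \<Rightarrow> nat \<Rightarrow> nat \<Rightarrow> real" where
  "kth_largest p t k = (if k \<in> {1..t} then rev (sort (map p [1..<Suc t])) ! (k - 1) else 0)"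

definition lower_bound :: "nat \<Rightarrow> (nat \<Rightarrow> real) \<Rightarrow> nat \<Rightarrow> real" where
  "lower_bound m p t =
     Max {(\<Sum>i=1..t. p i) / real m, kth_largest p t 1, 2 * kth_largest p t (m + 1)}"

definition small_at :: "real \<Rightarrow> nat \<Rightarrow> (nat \<Rightarrow> real) \<Rightarrow> nat \<Rightarrow> nat \<Rightarrow> bool" where
  "small_at c m p t i \<longleftrightarrow> p i \<le> (2 * c - 3) * lower_bound m p t"

definition small_load :: "real \<Rightarrow> nat \<Rightarrow> (nat \<Rightarrow> real) \<Rightarrow> nat \<Rightarrow> schedule \<Rightarrow> nat \<Rightarrow> real" where
  "small_load c m p t \<sigma> j = (\<Sum>i | \<sigma> i = Some j \<and> small_at c m p t i. p i)"

definition machines_A :: "nat \<Rightarrow> nat set" where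
  "machines_A m = {1..m div 2}"

definition machines_B :: "nat \<Rightarrow> nat set" where
  "machines_B m = {m div 2 + 1..m}"

definition least_loaded :: "(nat \<Rightarrow> real) \<Rightarrow> nat set \<Rightarrow> nat \<Rightarrow> bool" where
  "least_loaded f S j \<longleftrightarrow> is_arg_min f (\<lambda>j. j \<in> S) j"

definition largest_job :: "(nat \<Rightarrow> real) \<Rightarrow> schedule \<Rightarrow> nat \<Rightarrow> nat \<Rightarrow> bool" where
  "largest_job p \<sigma> j i \<longleftrightarrow> is_arg_max p (\<lambda>i. \<sigma> i = Some j) i"

definition arrival_choice ::
    "real \<Rightarrow> nat \<Rightarrow> (nat \<Rightarrow> real) \<Rightarrow> nat \<Rightarrow> schedule \<Rightarrow> nat \<Rightarrow> bool" where
  "arrival_choice c m p t \<sigma> j \<longleftrightarrow>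
     (if small_at c m p t t then
        let A' = {j \<in> machines_A m. small_load c m p t \<sigma> j \<le> (c - 1) * lower_bound m p t}
        in if A' \<noteq> {} then least_loaded (small_load c m p t \<sigma>) A' j
           else least_loaded (load p \<sigma>) (machines_B m) j
      else
        if \<exists>j\<in>machines_A m. load p \<sigma> j \<le> (3 - c) * lower_bound m p t
        then least_loaded (load p \<sigma>) (machines_A m) j
        else least_loaded (load p \<sigma>) (machines_B m) j)"

text \<open>\<open>arrival c m p t \<sigma>\<close>: schedule \<open>\<sigma>\<close> can arise after the first \<open>t\<close> jobs have arrived.\<close>

inductive arrival :: "real \<Rightarrow> nat \<Rightarrow> (nat \<Rightarrow> real) \<Rightarrow> nat \<Rightarrow> schedule \<Rightarrow> bool"
  for c m p where
  start: "arrival c m p 0 Map.empty"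
| assign: "arrival c m p (Suc t) (\<sigma>(Suc t \<mapsto> j))"
    if "arrival c m p t \<sigma>" and "arrival_choice c m p (Suc t) \<sigma> j"

text \<open>Machines of \<open>B\<close> without jobs contribute nothing to the set \<open>R\<close> of removed jobs.\<close>

definition remove_B :: "nat \<Rightarrow> (nat \<Rightarrow> real) \<Rightarrow> schedule \<Rightarrow> nat set \<Rightarrow> bool" where
  "remove_B m p \<sigma> R \<longleftrightarrow>
     (\<exists>r. (\<forall>j \<in> machines_B m \<inter> ran \<sigma>. largest_job p \<sigma> j (r j)) \<and> R = r ` (machines_B m \<inter> ran \<sigma>))"

text \<open>
  \<open>remove_A c m p L \<sigma> R \<sigma>' R'\<close>: the loop over the overloaded machines of \<open>A\<close>, started with
  schedule \<open>\<sigma>\<close> and removed jobs \<open>R\<close>, can stop with \<open>\<sigma>'\<close> and \<open>R'\<close>.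
\<close>

inductive remove_A ::
    "real \<Rightarrow> nat \<Rightarrow> (nat \<Rightarrow> real) \<Rightarrow> real \<Rightarrow> schedule \<Rightarrow> nat set \<Rightarrow> schedule \<Rightarrow> nat set \<Rightarrow> bool"
  for c m p L where
  stop: "remove_A c m p L \<sigma> R \<sigma> R"
    if "\<forall>j\<in>machines_A m. load p \<sigma> j \<le> (c - 1) * L"
| remove: "remove_A c m p L \<sigma> R \<sigma>' R'"
    if "j \<in> machines_A m" and "load p \<sigma> j > (c - 1) * L" and "largest_job p \<sigma> j i"
      and "remove_A c m p L (\<sigma>(i := None)) (insert i R) \<sigma>' R'"

definition reassign_choice ::
    "real \<Rightarrow> nat \<Rightarrow> (nat \<Rightarrow> real) \<Rightarrow> real \<Rightarrow> schedule \<Rightarrow> nat \<Rightarrow> nat \<Rightarrow> bool" where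
  "reassign_choice c m p L \<sigma> i j \<longleftrightarrow>
     (if \<exists>j\<in>machines_B m. load p \<sigma> j + p i \<le> c * L
      then j \<in> machines_B m \<and> load p \<sigma> j + p i \<le> c * L
      else least_loaded (load p \<sigma>) (machines_A m) j)"

inductive reassign ::
    "real \<Rightarrow> nat \<Rightarrow> (nat \<Rightarrow> real) \<Rightarrow> real \<Rightarrow> nat list \<Rightarrow> schedule \<Rightarrow> schedule \<Rightarrow> bool"
  for c m p L where
  empty: "reassign c m p L [] \<sigma> \<sigma>"
| step: "reassign c m p L (i # xs) \<sigma> \<sigma>'"
    if "reassign_choice c m p L \<sigma> i j" and "reassign c m p L xs (\<sigma>(i \<mapsto> j)) \<sigma>'"

definition ALG :: "real \<Rightarrow> nat \<Rightarrow> algorithm" where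
  "ALG c m p n \<sigma>' R \<longleftrightarrow>
     (\<exists>\<sigma> R\<^sub>B \<sigma>\<^sub>R xs.
        arrival c m p n \<sigma> \<and>
        remove_B m p \<sigma> R\<^sub>B \<and>
        remove_A c m p (lower_bound m p n) (\<sigma> |` (- R\<^sub>B)) R\<^sub>B \<sigma>\<^sub>R R \<and>
        distinct xs \<and> set xs = R \<and> sorted_wrt (\<lambda>i k. p i \<ge> p k) xs \<and>
        reassign c m p (lower_bound m p n) xs \<sigma>\<^sub>R \<sigma>')"


text \<open>
  The universally quantified guarantees above are not vacuous: every job sequence has a run, and
  every run ends with a complete schedule.
\<close>

lemma machines_A_ne: "2 \<le> m \<Longrightarrow> machines_A m \<noteq> {}"
  by (auto simp: machines_A_def)

lemma machines_B_ne: "2 \<le> m \<Longrightarrow> machines_B m \<noteq> {}"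
  by (auto simp: machines_B_def)

lemma ex_least_loaded: "finite S \<Longrightarrow> S \<noteq> {} \<Longrightarrow> \<exists>j. least_loaded f S j"
  unfolding least_loaded_def by (rule ex_is_arg_min_if_finite)

lemma ex_largest_job:
  assumes "finite (dom \<sigma>)" and "\<sigma> k = Some j"
  shows "\<exists>i. largest_job p \<sigma> j i"
proof -
  let ?S = "{i. \<sigma> i = Some j}"
  have fin: "finite ?S" by (rule finite_subset[OF _ assms(1)]) auto
  have "Max (p ` ?S) \<in> p ` ?S" using fin assms(2) by (intro Max_in) auto
  then obtain i where "i \<in> ?S" "p i = Max (p ` ?S)" by auto
  then show ?thesis using fin
    by (intro exI[of _ i]) (auto simp: largest_job_def is_arg_max_linorder)
qed

lemma least_loaded_in: "least_loaded f S j \<Longrightarrow> j \<in> S"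
  by (simp add: least_loaded_def is_arg_min_def)

lemma machines_AB: "j \<in> machines_A m \<or> j \<in> machines_B m \<longleftrightarrow> j \<in> {1..m}"
  by (auto simp: machines_A_def machines_B_def)

lemma ex_arrival_choice:
  assumes "2 \<le> m"
  shows "\<exists>j. arrival_choice c m p t \<sigma> j"
proof -
  have fin: "finite (machines_A m)" "finite (machines_B m)"
    by (auto simp: machines_A_def machines_B_def)
  have A': "\<exists>j. least_loaded f {j \<in> machines_A m. P j} j"
    if "{j \<in> machines_A m. P j} \<noteq> {}" for f P
    using that fin by (intro ex_least_loaded) auto
  show ?thesis
    using A' ex_least_loaded[OF fin(1) machines_A_ne[OF assms]]
      ex_least_loaded[OF fin(2) machines_B_ne[OF assms]]
    unfolding arrival_choice_def Let_def by meson
qed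

lemma arrival_choice_in: "arrival_choice c m p t \<sigma> j \<Longrightarrow> j \<in> {1..m}"
  unfolding machines_AB[symmetric] arrival_choice_def Let_def
  by (auto split: if_splits dest!: least_loaded_in)

lemma arrival_schedule: "arrival c m p n \<sigma> \<Longrightarrow> \<sigma> \<in> schedules m n"
proof (induction rule: arrival.induct)
  case (assign t \<sigma> j)
  then show ?case using arrival_choice_in[OF assign(2)]
    by (auto simp: schedules_def ran_def dom_def set_eq_iff)
qed (auto simp: schedules_def)

lemma ex_arrival: "2 \<le> m \<Longrightarrow> \<exists>\<sigma>. arrival c m p n \<sigma>"
proof (induction n)
  case (Suc n)
  then show ?case using ex_arrival_choice by (meson arrival.assign)
qed (auto intro: arrival.start)

lemma ex_remove_B:
  assumes "finite (dom \<sigma>)"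
  shows "\<exists>R. remove_B m p \<sigma> R"
proof -
  have "\<forall>j \<in> machines_B m \<inter> ran \<sigma>. \<exists>i. largest_job p \<sigma> j i"
    using ex_largest_job[OF assms] by (auto simp: ran_def)
  then obtain r where "\<forall>j \<in> machines_B m \<inter> ran \<sigma>. largest_job p \<sigma> j (r j)" by metis
  then show ?thesis by (auto simp: remove_B_def)
qed

lemma remove_B_subset: "remove_B m p \<sigma> R \<Longrightarrow> R \<subseteq> dom \<sigma>"
  by (auto simp: remove_B_def largest_job_def is_arg_max_def)

lemma ex_remove_A:
  assumes "finite (dom \<sigma>)" and "0 \<le> (c - 1) * L"
  shows "\<exists>\<sigma>' R'. remove_A c m p L \<sigma> R \<sigma>' R'"
  using assms(1)
proof (induction "card (dom \<sigma>)" arbitrary: \<sigma> R rule: less_induct)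
  case less
  show ?case
  proof (cases "\<forall>j\<in>machines_A m. load p \<sigma> j \<le> (c - 1) * L")
    case True
    then show ?thesis by (blast intro: remove_A.stop)
  next
    case False
    then obtain j where j: "j \<in> machines_A m" "load p \<sigma> j > (c - 1) * L" by force
    then have "{i. \<sigma> i = Some j} \<noteq> {}"
      using assms(2) by (metis load_def less_le_not_le order_trans sum.empty)
    then obtain k where "\<sigma> k = Some j" by blast
    then obtain i where i: "largest_job p \<sigma> j i"
      using ex_largest_job[OF less.prems] by blast
    then have "i \<in> dom \<sigma>" by (auto simp: largest_job_def is_arg_max_def)
    then have "card (dom (\<sigma>(i := None))) < card (dom \<sigma>)"
      using less.prems card_Diff1_less by fastforce
    with less.hyps less.prems
    obtain \<sigma>' R' where "remove_A c m p L (\<sigma>(i := None)) (insert i R) \<sigma>' R'"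
      by fastforce
    then show ?thesis using remove_A.remove j i by blast
  qed
qed

lemma remove_A_dom:
  assumes "remove_A c m p L \<sigma> R \<sigma>' R'"
  shows "dom \<sigma>' \<union> R' = dom \<sigma> \<union> R \<and> ran \<sigma>' \<subseteq> ran \<sigma>"
  using assms
proof (induction rule: remove_A.induct)
  case (remove j \<sigma> i R \<sigma>' R')
  have "i \<in> dom \<sigma>" using remove(3) by (auto simp: largest_job_def is_arg_max_def)
  moreover have "ran (\<sigma>(i := None)) \<subseteq> ran \<sigma>" by (auto simp: ran_def split: if_splits)
  ultimately show ?case using remove.IH unfolding dom_fun_upd by (simp del: fun_upd_apply) blast
qed auto

lemma ex_reassign:
  assumes "2 \<le> m"
  shows "\<exists>\<sigma>'. reassign c m p L xs \<sigma> \<sigma>'"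
proof (induction xs arbitrary: \<sigma>)
  case (Cons i xs)
  have fin: "finite (machines_A m)" by (auto simp: machines_A_def)
  then obtain j where "reassign_choice c m p L \<sigma> i j"
    using ex_least_loaded[OF fin machines_A_ne[OF assms]]
    unfolding reassign_choice_def by metis
  then show ?case using Cons by (blast intro: reassign.step)
qed (auto intro: reassign.empty)

lemma reassign_dom:
  assumes "reassign c m p L xs \<sigma> \<sigma>'" and "ran \<sigma> \<subseteq> {1..m}"
  shows "dom \<sigma>' = dom \<sigma> \<union> set xs \<and> ran \<sigma>' \<subseteq> {1..m}"
  using assms
proof (induction rule: reassign.induct)
  case (step \<sigma> i j xs \<sigma>')
  have "j \<in> {1..m}"
    using step(1) unfolding machines_AB[symmetric] reassign_choice_def
    by (auto split: if_splits dest!: least_loaded_in)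
  then have "ran (\<sigma>(i \<mapsto> j)) \<subseteq> {1..m}"
    using step.prems by (auto simp: ran_def split: if_splits)
  from step.IH[OF this] show ?case by auto
qed auto

lemma ex_sorted_list:
  fixes p :: "nat \<Rightarrow> real"
  assumes "finite R"
  shows "\<exists>xs. distinct xs \<and> set xs = R \<and> sorted_wrt (\<lambda>i k. p i \<ge> p k) xs"
proof (intro exI conjI)
  let ?xs = "sort_key (\<lambda>i. - p i) (sorted_list_of_set R)"
  show "distinct ?xs" "set ?xs = R" using assms by auto
  have "sorted (map (\<lambda>i. - p i) ?xs)" by (rule sorted_sort_key)
  then show "sorted_wrt (\<lambda>i k. p i \<ge> p k) ?xs" by (simp add: sorted_map)
qed

lemma lower_bound_nonneg:
  assumes "\<forall>i\<in>{1..n}. 0 < p i"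
  shows "0 \<le> lower_bound m p n"
proof -
  have "0 \<le> (\<Sum>i=1..n. p i) / real m"
    using assms by (intro divide_nonneg_nonneg sum_nonneg) (auto simp: less_imp_le)
  also have "\<dots> \<le> lower_bound m p n" unfolding lower_bound_def by (rule Max_ge) auto
  finally show ?thesis .
qed

lemma ALG_total:
  assumes "2 \<le> m" and "1 \<le> c" and "\<forall>i\<in>{1..n}. 0 < p i"
  shows "\<exists>\<sigma> R. ALG c m p n \<sigma> R"
proof -
  let ?L = "lower_bound m p n"
  obtain \<sigma> where \<sigma>: "arrival c m p n \<sigma>" using ex_arrival[OF assms(1)] by blast
  then have dom: "finite (dom \<sigma>)" using arrival_schedule by (fastforce simp: schedules_def)
  obtain RB where RB: "remove_B m p \<sigma> RB" using ex_remove_B[OF dom] by blast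
  have finB: "finite RB" using remove_B_subset[OF RB] dom by (rule finite_subset)
  have "finite (dom (\<sigma> |` (- RB)))" using dom by auto
  moreover have "0 \<le> (c - 1) * ?L" using assms(2) lower_bound_nonneg[OF assms(3)] by simp
  ultimately obtain \<sigma>R R where R: "remove_A c m p ?L (\<sigma> |` (- RB)) RB \<sigma>R R"
    using ex_remove_A by blast
  have "R \<subseteq> dom \<sigma> \<union> RB" using remove_A_dom[OF R] by auto
  then have "finite R" using dom finB by (metis finite_UnI finite_subset)
  then obtain xs where "distinct xs" "set xs = R" "sorted_wrt (\<lambda>i k. p i \<ge> p k) xs"
    using ex_sorted_list by blast
  moreover obtain \<sigma>' where "reassign c m p ?L xs \<sigma>R \<sigma>'" using ex_reassign[OF assms(1)] by blast
  ultimately show ?thesis using \<sigma> RB R unfolding ALG_def by blast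
qed

lemma ALG_schedule:
  assumes "ALG c m p n \<sigma>' R"
  shows "\<sigma>' \<in> schedules m n"
proof -
  obtain \<sigma> RB \<sigma>R xs where *: "arrival c m p n \<sigma>" "remove_B m p \<sigma> RB"
    "remove_A c m p (lower_bound m p n) (\<sigma> |` (- RB)) RB \<sigma>R R" "set xs = R"
    "reassign c m p (lower_bound m p n) xs \<sigma>R \<sigma>'"
    using assms unfolding ALG_def by blast
  have \<sigma>: "dom \<sigma> = {1..n}" "ran \<sigma> \<subseteq> {1..m}"
    using arrival_schedule[OF *(1)] by (auto simp: schedules_def)
  have "ran (\<sigma> |` (- RB)) \<subseteq> ran \<sigma>" by (auto simp: ran_def restrict_map_def split: if_splits)
  then have "ran \<sigma>R \<subseteq> {1..m}" using remove_A_dom[OF *(3)] \<sigma> by blast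
  from reassign_dom[OF *(5) this] show ?thesis
    using remove_A_dom[OF *(3)] remove_B_subset[OF *(2)] \<sigma> *(4) by (auto simp: schedules_def)
qed

end

theory Submission
  imports Defs
begin

text \<open>
  Write \<open>L\<close> for the lower bound \<open>L\<^sub>n\<close> on the optimum.

  Competitiveness: suppose that a job of size \<open>q\<close> from \<open>R\<close> fits on no machine. The loads then sum up to
  more than \<open>m (5/3 L - q)\<close>, so \<open>q > 2/3 L\<close>. Every machine of \<open>A\<close> already got a job of size at
  least \<open>q\<close>, and since at most \<open>m\<close> jobs exceed \<open>L/2\<close>, some machine of \<open>B\<close> has none of them. It
  carried more than \<open>2/3 L\<close> after losing its largest job. Looking at the last job assigned to
  this machine, that is only possible if small jobs overflowed from \<open>A\<close> to \<open>B\<close>, and then each machine of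
  \<open>A\<close> keeps a load of at least \<open>L/3\<close> in the removal phase. Now the total load exceeds \<open>m L\<close>.

  Migrations: every machine of \<open>A\<close> loses at most seven jobs. Since a large job is assigned at load at
  most \<open>4/3 L\<^sub>t\<close> and has size more than \<open>L\<^sub>t/3\<close>, it increases the load by a factor \<open>5/4\<close>, so removing the
  last five large jobs is enough if no small job arrived in between. At the arrival of the last small
  job, at most four jobs of the machine are not small, and the others have load at most \<open>2/3 L\<^sub>t\<close>.
\<close>

abbreviation jobs :: "schedule \<Rightarrow> nat \<Rightarrow> nat set" where
  "jobs \<sigma> j \<equiv> {i. \<sigma> i = Some j}"

section \<open>The lower bound\<close>

lemma card_greater_eq_length_filter:
  "card {i\<in>{1..t}. p i > x} = length (filter (\<lambda>y. y > x) (rev (sort (map p [1..<Suc t]))))"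
  for x :: real
proof -
  have "length (filter (\<lambda>y. y > x) (rev (sort (map p [1..<Suc t]))))
      = length (filter (\<lambda>i. p i > x) [1..<Suc t])"
    by (simp only: rev_filter[symmetric] filter_sort length_rev length_sort filter_map length_map o_def)
  also have "\<dots> = card (set (filter (\<lambda>i. p i > x) [1..<Suc t]))"
    by (rule distinct_card[symmetric]) simp
  also have "set (filter (\<lambda>i. p i > x) [1..<Suc t]) = {i\<in>{1..t}. p i > x}"
    by auto
  finally show ?thesis by simp
qed

text \<open>In the descending list the entries above \<open>x\<close> form a prefix, so the entry at
  \<open>k - 1\<close> decides how many there are. This counting form replaces sorted lists from
  here on.\<close>

lemma kth_largest_le_iff:
  assumes "1 \<le> k" and "0 \<le> x"
  shows "kth_largest p t k \<le> x \<longleftrightarrow> card {i\<in>{1..t}. p i > x} < k"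
proof (cases "k \<le> t")
  case False
  \<comment> \<open>Beyond \<open>t\<close> the value is the default 0, which is at most
    \<open>x\<close>, and there are fewer than \<open>k\<close> jobs.\<close>
  have "card {i\<in>{1..t}. p i > x} \<le> card {1..t}" by (rule card_mono) auto
  with False assms show ?thesis by (simp add: kth_largest_def)
next
  case True
  define xs where "xs = rev (sort (map p [1..<Suc t]))"
  have len: "length xs = t" by (simp add: xs_def)
  have desc: "xs ! j \<le> xs ! i" if "i \<le> j" "j < t" for i j
  proof -
    have "sorted (rev xs)" by (simp add: xs_def)
    then show ?thesis using that len sorted_rev_nth_mono by blast
  qed
  have card: "card {i\<in>{1..t}. p i > x} = card {i. i < t \<and> xs ! i > x}"
    unfolding card_greater_eq_length_filter xs_def[symmetric] length_filter_conv_card len ..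
  have kth: "kth_largest p t k = xs ! (k - 1)"
    using True assms by (simp add: kth_largest_def xs_def)
  show ?thesis
  proof
    assume *: "kth_largest p t k \<le> x"
    have "{i. i < t \<and> xs ! i > x} \<subseteq> {..<k - 1}"
    proof
      fix i assume "i \<in> {i. i < t \<and> xs ! i > x}"
      then have "i < t" "xs ! i > x" by auto
      then show "i \<in> {..<k - 1}" using desc[of "k - 1" i] * kth by force
    qed
    then have "card {i. i < t \<and> xs ! i > x} \<le> card {..<k - 1}" by (intro card_mono) auto
    then show "card {i\<in>{1..t}. p i > x} < k" using card assms by simp
  next
    assume *: "card {i\<in>{1..t}. p i > x} < k"
    show "kth_largest p t k \<le> x"
    proof (rule ccontr)
      assume "\<not> kth_largest p t k \<le> x"
      then have gt: "xs ! (k - 1) > x" by (simp add: kth)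
      have "{..<k} \<subseteq> {i. i < t \<and> xs ! i > x}"
      proof
        fix i assume "i \<in> {..<k}"
        then show "i \<in> {i. i < t \<and> xs ! i > x}"
          using desc[of i "k - 1"] gt True by force
      qed
      then have "card {..<k} \<le> card {i. i < t \<and> xs ! i > x}" by (intro card_mono) auto
      then show False using * card by simp
    qed
  qed
qed

text \<open>Used in both directions: with \<open>x\<close> a makespan it compares the lower bound
  with a schedule, and with \<open>x\<close> the lower bound itself it yields the volume, size and
  counting bounds.\<close>

lemma lower_bound_le_iff:
  assumes "1 \<le> m" and "0 \<le> x"
  shows "lower_bound m p t \<le> x \<longleftrightarrow>
    (\<Sum>i=1..t. p i) \<le> real m * x \<and> (\<forall>i\<in>{1..t}. p i \<le> x) \<and> card {i\<in>{1..t}. p i > x / 2} \<le> m"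
proof -
  have 1: "kth_largest p t 1 \<le> x \<longleftrightarrow> (\<forall>i\<in>{1..t}. p i \<le> x)"
    using assms by (subst kth_largest_le_iff) (auto simp: card_gt_0_iff not_less)
  have 2: "2 * kth_largest p t (m + 1) \<le> x \<longleftrightarrow> card {i\<in>{1..t}. p i > x / 2} \<le> m"
    using assms kth_largest_le_iff[of "m + 1" "x / 2" p t] by (simp add: mult.commute less_Suc_eq_le)
  have 3: "(\<Sum>i=1..t. p i) / real m \<le> x \<longleftrightarrow> (\<Sum>i=1..t. p i) \<le> real m * x"
    using assms by (simp add: field_simps)
  have "lower_bound m p t \<le> x \<longleftrightarrow>
    (\<Sum>i=1..t. p i) / real m \<le> x \<and> kth_largest p t 1 \<le> x \<and> 2 * kth_largest p t (m + 1) \<le> x"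
    unfolding lower_bound_def by (subst Max_le_iff) auto
  then show ?thesis unfolding 1 2 3 .
qed

section \<open>Comparison of the lower bound with the optimum\<close>

lemma sum_load:
  assumes "finite (dom \<sigma>)" and "ran \<sigma> \<subseteq> M" and "finite M"
  shows "(\<Sum>j\<in>M. load p \<sigma> j) = sum p (dom \<sigma>)"
proof -
  have "(\<Sum>j\<in>M. load p \<sigma> j) = sum p (\<Union>j\<in>M. jobs \<sigma> j)"
    unfolding load_def
    by (rule sum.UNION_disjoint[symmetric])
       (use assms in \<open>auto intro: finite_subset[OF _ assms(1)]\<close>)
  also have "(\<Union>j\<in>M. jobs \<sigma> j) = dom \<sigma>"
    using assms(2) by (fastforce simp: ran_def)
  finally show ?thesis .
qed

lemma finite_schedules: "finite (schedules m n)"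
  by (rule finite_subset[OF _ finite_set_of_finite_maps[of "{1..n}" "{1..m}"]])
     (auto simp: schedules_def)

lemma load_le_makespan: "j \<in> {1..m} \<Longrightarrow> load p \<sigma> j \<le> makespan m p \<sigma>"
  unfolding makespan_def by (rule Max_ge) auto

lemma sum_le_load:
  assumes "finite (dom \<sigma>)" and "\<And>i. i \<in> dom \<sigma> \<Longrightarrow> 0 \<le> p i" and "T \<subseteq> jobs \<sigma> j"
  shows "sum p T \<le> load p \<sigma> j"
  unfolding load_def
  by (rule sum_mono2) (use assms in \<open>auto intro: finite_subset[OF _ assms(1)]\<close>)

lemma lower_bound_le_makespan:
  assumes "1 \<le> m" and pos: "\<forall>i\<in>{1..n}. 0 < p i" and \<sigma>: "\<sigma> \<in> schedules m n"
  shows "lower_bound m p n \<le> makespan m p \<sigma>"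
proof -
  let ?x = "makespan m p \<sigma>"
  have dom: "dom \<sigma> = {1..n}" and ran: "ran \<sigma> \<subseteq> {1..m}" using \<sigma> by (auto simp: schedules_def)
  have fin: "finite (dom \<sigma>)" by (simp add: dom)
  have nn: "0 \<le> p i" if "i \<in> dom \<sigma>" for i using that pos dom by (auto simp: less_imp_le)
  have mem: "\<sigma> i = Some j \<Longrightarrow> j \<in> {1..m}" for i j using ran by (auto simp: ran_def)
  have "0 \<le> load p \<sigma> 1" using sum_le_load[OF fin, where p = p and T = "{}" and j = 1] nn by simp
  also have "\<dots> \<le> ?x" using assms by (intro load_le_makespan) auto
  finally have x: "0 \<le> ?x" .
  have T: "sum p T \<le> ?x" if "T \<subseteq> jobs \<sigma> j" "j \<in> {1..m}" for T j
    using sum_le_load[OF fin, where p = p, OF nn that(1)] load_le_makespan[OF that(2), of p \<sigma>] by simp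
  have "(\<Sum>i=1..n. p i) = (\<Sum>j\<in>{1..m}. load p \<sigma> j)"
    using sum_load[OF fin ran] dom by simp
  also have "\<dots> \<le> (\<Sum>j\<in>{1..m}. ?x)" by (intro sum_mono load_le_makespan)
  finally have 1: "(\<Sum>i=1..n. p i) \<le> real m * ?x" by simp
  have 2: "p i \<le> ?x" if "i \<in> {1..n}" for i
  proof -
    have "i \<in> dom \<sigma>" using that dom by simp
    then obtain j where j: "\<sigma> i = Some j" by (auto dest: domD)
    show ?thesis using T[of "{i}" j] mem[OF j] j by simp
  qed
  \<comment> \<open>With more than \<open>m\<close> such jobs two of them share a machine, and their
    sum exceeds the makespan.\<close>
  have 3: "card {i\<in>{1..n}. p i > ?x / 2} \<le> m"
  proof (rule ccontr)
    let ?H = "{i\<in>{1..n}. p i > ?x / 2}"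
    assume "\<not> card ?H \<le> m"
    then have "card ((\<lambda>i. the (\<sigma> i)) ` ?H) < card ?H"
    proof -
      have "the (\<sigma> i) \<in> {1..m}" if "i \<in> ?H" for i
      proof -
        have "i \<in> dom \<sigma>" using that dom by simp
        then show ?thesis using mem by force
      qed
      then have "(\<lambda>i. the (\<sigma> i)) ` ?H \<subseteq> {1..m}" by blast
      then have "card ((\<lambda>i. the (\<sigma> i)) ` ?H) \<le> card {1..m}" by (intro card_mono) auto
      then show ?thesis using \<open>\<not> card ?H \<le> m\<close> by simp
    qed
    then have "\<not> inj_on (\<lambda>i. the (\<sigma> i)) ?H" by (rule pigeonhole)
    then obtain i k where ik: "i \<in> ?H" "k \<in> ?H" "i \<noteq> k" "the (\<sigma> i) = the (\<sigma> k)"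
      by (auto simp: inj_on_def)
    then have "i \<in> dom \<sigma>" "k \<in> dom \<sigma>" using dom by auto
    then obtain j where j: "\<sigma> i = Some j" "\<sigma> k = Some j" using ik(4) by auto
    have "p i + p k \<le> ?x" using T[of "{i, k}" j] mem[OF j(1)] j ik(3) by simp
    then show False using ik by auto
  qed
  show ?thesis using 1 2 3 lower_bound_le_iff[OF assms(1) x] by blast
qed

text \<open>A schedule must exist for the minimum in \<open>opt\<close> to be meaningful; the
  outcome of a run will provide it.\<close>

lemma lower_bound_le_opt:
  assumes "1 \<le> m" and "\<forall>i\<in>{1..n}. 0 < p i" and "schedules m n \<noteq> {}"
  shows "lower_bound m p n \<le> opt m p n"
  unfolding opt_def
  by (subst Min_ge_iff) (use assms finite_schedules lower_bound_le_makespan in auto)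

lemma least_loaded_le: "least_loaded f S j \<Longrightarrow> k \<in> S \<Longrightarrow> f j \<le> f k"
  by (auto simp: least_loaded_def is_arg_min_linorder)

lemma largest_job_in: "largest_job p \<sigma> j i \<Longrightarrow> \<sigma> i = Some j"
  by (simp add: largest_job_def is_arg_max_def)

lemma largest_job_ge: "largest_job p \<sigma> j i \<Longrightarrow> \<sigma> k = Some j \<Longrightarrow> p k \<le> p i"
  by (auto simp: largest_job_def is_arg_max_linorder)

lemma small_at_5_3: "small_at (5/3) m p t i \<longleftrightarrow> p i \<le> lower_bound m p t / 3"
  by (simp add: small_at_def)

section \<open>Machines that keep few jobs in excess\<close>

text \<open>\<open>D\<close> may be any set of jobs, so a witness can follow the order of arrival
  although the algorithm removes largest jobs.\<close>

definition excess_at_most :: "(nat \<Rightarrow> real) \<Rightarrow> nat set \<Rightarrow> real \<Rightarrow> nat \<Rightarrow> bool" where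
  "excess_at_most p X x k \<longleftrightarrow> (\<exists>D\<subseteq>X. card D \<le> k \<and> sum p (X - D) \<le> x)"

text \<open>Exchange argument: if \<open>i\<close> lies outside \<open>D\<close>, putting some
  \<open>d\<close> of \<open>D\<close> back in its place does not increase the remaining sum, since
  \<open>p d\<close> is at most \<open>p i\<close>.\<close>

lemma excess_at_most_remove_largest:
  assumes ex: "excess_at_most p X x k" and fin: "finite X" and gt: "sum p X > x"
    and i: "i \<in> X" and max: "\<forall>l\<in>X. p l \<le> p i"
  shows "0 < k \<and> excess_at_most p (X - {i}) x (k - 1)"
proof -
  obtain D where D: "D \<subseteq> X" "card D \<le> k" "sum p (X - D) \<le> x"
    using ex by (auto simp: excess_at_most_def)
  have finD: "finite D" using D fin finite_subset by blast
  have "D \<noteq> {}" using D gt by auto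
  then have k: "0 < k" using D finD by (metis card_gt_0_iff less_le_trans)
  obtain d where d: "d \<in> D" "i \<in> D \<longrightarrow> d = i" using \<open>D \<noteq> {}\<close> by blast
  have "sum p ((X - {i}) - (D - {d})) \<le> x"
  proof (cases "i \<in> D")
    case True
    then have "(X - {i}) - (D - {d}) = X - D" using d by auto
    then show ?thesis using D by simp
  next
    case False
    then have "(X - {i}) - (D - {d}) = insert d (X - D - {i})" using d D by auto
    moreover have "sum p (insert d (X - D - {i})) = p d + sum p (X - D - {i})"
      using fin d by (subst sum.insert) auto
    moreover have "sum p (X - D - {i}) = sum p (X - D) - p i"
      using fin i False by (simp add: sum_diff1)
    ultimately show ?thesis using D max d by force
  qed
  moreover have "card (D - {d}) \<le> k - 1" using d finD D by simp
  moreover have "D - {d} \<subseteq> X - {i}" using D d by auto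
  ultimately show ?thesis using k unfolding excess_at_most_def by blast
qed

text \<open>\<open>d j\<close> is a budget of removals for machine \<open>j\<close>. An overloaded
  machine always has budget left and pays one unit per removal, so \<open>card R\<close> plus all
  budgets never grows.\<close>

lemma card_remove_A_le:
  assumes "remove_A c m p L \<sigma> R \<sigma>' R'" and "finite (dom \<sigma>)" and "finite R"
    and "\<forall>j\<in>machines_A m. excess_at_most p (jobs \<sigma> j) ((c - 1) * L) (d j)"
  shows "card R' \<le> card R + sum d (machines_A m)"
  using assms
proof (induction arbitrary: d rule: remove_A.induct)
  case (remove j \<sigma> i R \<sigma>' R')
  let ?d = "d(j := d j - 1)"
  have fin: "finite (jobs \<sigma> k)" for k
    by (rule finite_subset[OF _ remove.prems(1)]) auto
  have finA: "finite (machines_A m)" by (simp add: machines_A_def)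
  have step: "0 < d j \<and> excess_at_most p (jobs \<sigma> j - {i}) ((c - 1) * L) (d j - 1)"
  proof (rule excess_at_most_remove_largest)
    show "excess_at_most p (jobs \<sigma> j) ((c - 1) * L) (d j)" using remove.prems remove.hyps by blast
    show "sum p (jobs \<sigma> j) > (c - 1) * L" using remove.hyps by (simp add: load_def)
    show "i \<in> jobs \<sigma> j" using largest_job_in[OF remove.hyps(3)] by simp
    show "\<forall>l\<in>jobs \<sigma> j. p l \<le> p i" using largest_job_ge[OF remove.hyps(3)] by simp
  qed (rule fin)
  have "excess_at_most p (jobs (\<sigma>(i := None)) k) ((c - 1) * L) (?d k)"
    if "k \<in> machines_A m" for k
  proof (cases "k = j")
    case True
    have "jobs (\<sigma>(i := None)) j = jobs \<sigma> j - {i}" by auto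
    then show ?thesis using step True by simp
  next
    case False
    then have "jobs (\<sigma>(i := None)) k = jobs \<sigma> k" "?d k = d k"
      using largest_job_in[OF remove.hyps(3)] by auto
    then show ?thesis using remove.prems(3) that by simp
  qed
  then have "\<forall>k\<in>machines_A m. excess_at_most p (jobs (\<sigma>(i := None)) k) ((c - 1) * L) (?d k)"
    by blast
  moreover have "finite (dom (\<sigma>(i := None)))" using remove.prems(1) by simp
  ultimately have "card R' \<le> card (insert i R) + sum ?d (machines_A m)"
    using remove.IH remove.prems(2) by blast
  moreover have "sum ?d (machines_A m) + 1 = sum d (machines_A m)"
  proof -
    have "sum d (machines_A m) = d j + sum d (machines_A m - {j})"
      by (rule sum.remove[OF finA remove.hyps(1)])
    moreover have "sum ?d (machines_A m) = (d j - 1) + sum ?d (machines_A m - {j})"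
      using sum.remove[OF finA remove.hyps(1), of ?d] by simp
    moreover have "sum ?d (machines_A m - {j}) = sum d (machines_A m - {j})"
      by (rule sum.cong) auto
    ultimately show ?thesis using step by simp
  qed
  moreover have "card (insert i R) \<le> card R + 1" using remove.prems(2) by (simp add: card_insert_if)
  ultimately show ?case by simp
qed auto

text \<open>\<open>D\<close> stands for the last \<open>r\<close> jobs assigned, all of them large on arrival.\<close>

definition late_part :: "(nat \<Rightarrow> real) \<Rightarrow> nat set \<Rightarrow> real \<Rightarrow> nat \<Rightarrow> nat set \<Rightarrow> bool" where
  "late_part p X L r D \<longleftrightarrow> D \<subseteq> X \<and> card D \<le> r \<and> (5/4) ^ r * sum p (X - D) \<le> sum p X \<and>
     (0 < r \<longrightarrow> (5/4) ^ (r - 1) * sum p (X - D) \<le> 4/3 * L)"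

text \<open>
  \<open>Y\<close> stands for the jobs of a machine just after the small job \<open>s\<close> was assigned at a time with lower
  bound \<open>l\<close>, and \<open>H\<close> for those that are not small. The value \<open>l = 0\<close> covers \<open>Y = {}\<close>.
\<close>

definition after_small :: "(nat \<Rightarrow> real) \<Rightarrow> nat set \<Rightarrow> real \<Rightarrow> bool" where
  "after_small p Y l \<longleftrightarrow> (\<exists>H s. H \<subseteq> Y \<and> card H \<le> 4 \<and> (\<forall>i\<in>H. l / 3 < p i \<and> p i \<le> l) \<and>
     sum p (Y - H - {s}) \<le> 2/3 * l \<and> sum p (Y - H) \<le> l)"

text \<open>\<open>k\<close> counts the jobs assigned after the last small one.\<close>

definition A_invariant :: "(nat \<Rightarrow> real) \<Rightarrow> nat set \<Rightarrow> real \<Rightarrow> bool" where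
  "A_invariant p X L \<longleftrightarrow> (\<exists>k. (\<forall>r\<le>k. \<exists>D. late_part p X L r D) \<and>
     (5 \<le> k \<or> (\<exists>D l. late_part p X L k D \<and> 0 \<le> l \<and> l \<le> L \<and> after_small p (X - D) l)))"

section \<open>Maintaining the invariant of a machine of \<open>A\<close>\<close>

lemma late_part_0: "late_part p X L 0 {}"
  by (simp add: late_part_def)

lemma late_part_mono: "late_part p X L r D \<Longrightarrow> L \<le> L' \<Longrightarrow> late_part p X L' r D"
  by (auto simp: late_part_def)

text \<open>A job above \<open>L / 3\<close> added at load at most \<open>4/3 * L\<close> raises the
  load at least by the factor 5/4. The last clause of \<open>late_part\<close> has exponent
  \<open>r - 1\<close> because it measures against the load just before this job.\<close>

lemma late_part_insert:
  assumes "late_part p X L r D" and "finite X" and "i \<notin> X"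
    and "L / 3 < p i" and "sum p X \<le> 4/3 * L"
  shows "late_part p (insert i X) L (Suc r) (insert i D)"
proof -
  have D: "D \<subseteq> X" "card D \<le> r" "(5/4) ^ r * sum p (X - D) \<le> sum p X"
    using assms(1) by (auto simp: late_part_def)
  have eq: "insert i X - insert i D = X - D" using assms(3) by auto
  have "finite D" using D assms(2) finite_subset by blast
  then have "card (insert i D) \<le> Suc r" using D(2) by (simp add: card_insert_if)
  moreover have "(5/4) ^ Suc r * sum p (X - D) \<le> sum p (insert i X)"
    using D(3) assms by simp
  moreover have "(5/4) ^ r * sum p (X - D) \<le> 4/3 * L" using D(3) assms(5) by linarith
  ultimately show ?thesis using D(1) unfolding late_part_def eq by auto
qed

lemma A_invariant_empty: "0 \<le> L \<Longrightarrow> A_invariant p {} L"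
  unfolding A_invariant_def after_small_def
  by (rule exI[of _ 0]) (auto intro!: exI[of _ "{}"] late_part_0 exI[of _ L])

lemma A_invariant_mono:
  assumes "A_invariant p X L" and "L \<le> L'"
  shows "A_invariant p X L'"
  using assms late_part_mono[OF _ assms(2)] unfolding A_invariant_def
  by (meson order_trans)

text \<open>The new job joins every late part, so \<open>X - D\<close> and its witness for
  \<open>after_small\<close> stay the same while \<open>k\<close> grows by one.\<close>

lemma A_invariant_large:
  assumes inv: "A_invariant p X L" and "finite X" and "i \<notin> X"
    and "L / 3 < p i" and "sum p X \<le> 4/3 * L"
  shows "A_invariant p (insert i X) L"
proof -
  note ins = late_part_insert[OF _ assms(2-5)]
  obtain k where k: "\<forall>r\<le>k. \<exists>D. late_part p X L r D"
    and k5: "5 \<le> k \<or> (\<exists>D l. late_part p X L k D \<and> 0 \<le> l \<and> l \<le> L \<and> after_small p (X - D) l)"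
    using inv unfolding A_invariant_def by blast
  have 1: "\<exists>D. late_part p (insert i X) L r D" if "r \<le> Suc k" for r
  proof (cases r)
    case 0
    then show ?thesis using late_part_0 by blast
  next
    case (Suc r')
    then show ?thesis using that k ins by (metis Suc_le_mono)
  qed
  have 2: "5 \<le> Suc k \<or> (\<exists>D l. late_part p (insert i X) L (Suc k) D \<and> 0 \<le> l \<and> l \<le> L \<and>
      after_small p (insert i X - D) l)"
  proof (cases "5 \<le> k")
    case False
    then obtain D l where D: "late_part p X L k D" "0 \<le> l" "l \<le> L" "after_small p (X - D) l"
      using k5 by blast
    moreover have "insert i X - insert i D = X - D" using assms(3) by auto
    ultimately show ?thesis using ins[OF D(1)] by metis
  qed simp
  show ?thesis unfolding A_invariant_def using 1 2 by blast
qed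

text \<open>The count \<open>k\<close> restarts at 0 with \<open>l = L\<close> and
  \<open>s = i\<close>; adding \<open>i\<close> to the small jobs takes their sum from
  \<open>2/3 * L\<close> to at most \<open>L\<close>.\<close>

lemma A_invariant_small:
  assumes "finite X" and "i \<notin> X" and "0 \<le> L" and "p i \<le> L / 3"
    and "\<forall>k\<in>X. p k \<le> L" and "card {k\<in>X. L / 3 < p k} \<le> 4"
    and "sum p {k\<in>X. p k \<le> L / 3} \<le> 2/3 * L"
  shows "A_invariant p (insert i X) L"
proof -
  let ?H = "{k\<in>X. L / 3 < p k}"
  have 1: "insert i X - ?H - {i} = {k\<in>X. p k \<le> L / 3}" using assms(2) by auto
  have 2: "insert i X - ?H = insert i {k\<in>X. p k \<le> L / 3}" using assms(2) by auto
  have "after_small p (insert i X) L" unfolding after_small_def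
  proof (intro exI[of _ ?H] exI[of _ i] conjI)
    show "sum p (insert i X - ?H) \<le> L" unfolding 2 using assms by simp
  qed (use assms 1 in auto)
  then show ?thesis unfolding A_invariant_def
    using assms(3) late_part_0 by (intro exI[of _ 0]) (metis Diff_empty le_zero_eq order_refl)
qed

lemma A_invariant_excess:
  assumes inv: "A_invariant p X L" and fin: "finite X" and L: "0 \<le> L"
  shows "excess_at_most p X (2/3 * L) 7"
proof -
  obtain k where k: "\<forall>r\<le>k. \<exists>D. late_part p X L r D"
    and k5: "5 \<le> k \<or> (\<exists>D l. late_part p X L k D \<and> 0 \<le> l \<and> l \<le> L \<and> after_small p (X - D) l)"
    using inv unfolding A_invariant_def by blast
  show ?thesis
  proof (cases "5 \<le> k")
    case True
    then obtain D where "late_part p X L 5 D" using k by blast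
    \<comment> \<open>Since (5/4)^4 = 625/256 is more than 2, the jobs before the last five sum up
      to at most \<open>2/3 * L\<close>.\<close>
    then have "D \<subseteq> X" "card D \<le> 5" "(5/4) ^ 4 * sum p (X - D) \<le> 4/3 * L"
      by (auto simp: late_part_def)
    then show ?thesis unfolding excess_at_most_def
      by (intro exI[of _ D]) (use L in \<open>simp add: power_divide\<close>)
  next
    case False
    then obtain D l where D: "late_part p X L k D" and l: "0 \<le> l" "l \<le> L"
      and as: "after_small p (X - D) l" using k5 by blast
    have DX: "D \<subseteq> X" "card D \<le> k" and Y: "0 < k \<longrightarrow> (5/4) ^ (k - 1) * sum p (X - D) \<le> 4/3 * L"
      using D by (auto simp: late_part_def)
    obtain H s where H: "H \<subseteq> X - D" "card H \<le> 4" "\<forall>i\<in>H. l / 3 < p i \<and> p i \<le> l"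
      and rest: "sum p (X - D - H - {s}) \<le> 2/3 * l" "sum p (X - D - H) \<le> l"
      using as unfolding after_small_def by blast
    have finH: "finite H" "finite D" using H DX fin by (meson finite_Diff finite_subset)+
    have witness: ?thesis if "E \<subseteq> X - D" "card E + k \<le> 7" "sum p (X - D - E) \<le> 2/3 * L" for E
    proof -
      have "card (D \<union> E) \<le> 7" using card_Un_le[of D E] that DX by linarith
      moreover have "X - (D \<union> E) = X - D - E" by auto
      ultimately show ?thesis unfolding excess_at_most_def using that DX
        by (intro exI[of _ "D \<union> E"]) auto
    qed
    \<comment> \<open>\<open>after_small\<close> does not place \<open>s\<close> in
      \<open>X - D\<close>, hence the intersection in the witness.\<close>
    have all: ?thesis if "card H + 1 + k \<le> 7"
    proof (rule witness[of "(H \<union> {s}) \<inter> (X - D)"])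
      have "card ((H \<union> {s}) \<inter> (X - D)) \<le> card (H \<union> {s})" using finH by (intro card_mono) auto
      also have "\<dots> \<le> card H + 1" using card_Un_le[of H "{s}"] by simp
      finally show "card ((H \<union> {s}) \<inter> (X - D)) + k \<le> 7" using that by simp
      have "X - D - (H \<union> {s}) \<inter> (X - D) = X - D - H - {s}" by auto
      then show "sum p (X - D - (H \<union> {s}) \<inter> (X - D)) \<le> 2/3 * L" using rest l by simp
    qed auto
    \<comment> \<open>The pairs \<open>(k, card H)\<close> left are (3,4), (4,3) and (4,4), and only
      \<open>7 - k\<close> jobs of \<open>H\<close> may go. The remainder is at most
      \<open>l\<close> plus the rest of \<open>H\<close>, which grows with \<open>l\<close>, and at
      most \<open>sum p (X - D)\<close> minus \<open>(7 - k) * l / 3\<close>, which falls with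
      \<open>l\<close>. For every \<open>l\<close> one of the two bounds is at most
      \<open>2/3 * L\<close>.\<close>
    have part: ?thesis if "card H + 1 + k > 7" "k \<in> {3, 4}" "7 - k \<le> card H"
    proof -
      note hyps = that
      obtain E where E: "E \<subseteq> H" "card E = 7 - k" "finite E"
        using obtain_subset_with_card_n[OF hyps(3)] by blast
      have "real (card E) * (l / 3) \<le> sum p E"
        using sum_bounded_below[of E "l / 3" p] E H by force
      moreover have "sum p (X - D - E) = sum p (X - D) - sum p E"
        using fin E H by (intro sum_diff) auto
      moreover have "sum p (X - D - E) = sum p (H - E) + sum p (X - D - H)"
        using fin finH E H by (subst sum.union_disjoint[symmetric]) (auto intro: sum.cong)
      moreover have "sum p (H - E) \<le> real (card (H - E)) * l"
        using sum_bounded_above[of "H - E" p l] H by auto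
      moreover have "card (H - E) = card H - (7 - k)" using E finH by (simp add: card_Diff_subset)
      moreover have "k = 3 \<and> card H = 4 \<or> k = 4 \<and> card H = 3 \<or> k = 4 \<and> card H = 4"
        using hyps H(2) by auto
      ultimately have "sum p (X - D - E) \<le> 2/3 * L"
        using rest Y l E(2) by (elim disjE conjE) (simp_all add: power_divide)
      then show ?thesis using witness[of E] E H hyps(2) by auto
    qed
    show ?thesis
      using all part False H(2) by (cases "card H + 1 + k \<le> 7") force+
  qed
qed

section \<open>The arrival phase\<close>

text \<open>After the last assignment to \<open>j\<close> its set of jobs no longer changes, so its
  final load can be studied at that moment.\<close>

lemma arrival_last_assignment:
  assumes "arrival c m p n \<sigma>" and "\<sigma> i = Some j"
  shows "\<exists>t \<sigma>\<^sub>0. t < n \<and> arrival c m p t \<sigma>\<^sub>0 \<and> arrival_choice c m p (Suc t) \<sigma>\<^sub>0 j \<and> \<sigma>\<^sub>0 \<subseteq>\<^sub>m \<sigma> \<and>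
    jobs \<sigma> j = insert (Suc t) (jobs \<sigma>\<^sub>0 j)"
  using assms
proof (induction arbitrary: i rule: arrival.induct)
  case (assign t \<sigma> j')
  have "Suc t \<notin> dom \<sigma>" using arrival_schedule[OF assign(1)] by (auto simp: schedules_def)
  then have le: "\<sigma> \<subseteq>\<^sub>m \<sigma>(Suc t \<mapsto> j')" by (auto simp: map_le_def)
  show ?case
  proof (cases "j = j'")
    case True
    then have "jobs (\<sigma>(Suc t \<mapsto> j')) j = insert (Suc t) (jobs \<sigma> j)" by auto
    then show ?thesis using assign(1,2) le True by blast
  next
    case False
    then have "\<sigma> i = Some j" using assign.prems by (auto split: if_splits)
    from assign.IH[OF this] obtain t' \<sigma>\<^sub>0 where t': "t' < t" "arrival c m p t' \<sigma>\<^sub>0"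
      "arrival_choice c m p (Suc t') \<sigma>\<^sub>0 j" "\<sigma>\<^sub>0 \<subseteq>\<^sub>m \<sigma>" "jobs \<sigma> j = insert (Suc t') (jobs \<sigma>\<^sub>0 j)"
      by blast
    moreover have "jobs (\<sigma>(Suc t \<mapsto> j')) j = jobs \<sigma> j"
      using False \<open>Suc t \<notin> dom \<sigma>\<close> by auto
    ultimately show ?thesis using map_le_trans[OF t'(4) le] less_Suc_eq by metis
  qed
qed auto

lemma machines_AB_Un: "machines_A m \<union> machines_B m = {1..m}"
  by (auto simp: machines_A_def machines_B_def)

lemma machines_AB_disjoint: "machines_A m \<inter> machines_B m = {}"
  by (auto simp: machines_A_def machines_B_def)

lemma finite_machines: "finite (machines_A m)" "finite (machines_B m)"
  by (auto simp: machines_A_def machines_B_def)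

lemma card_machines: "card (machines_A m) = m div 2" "card (machines_B m) = m - m div 2"
  by (auto simp: machines_A_def machines_B_def)

lemma sum_machines:
  "sum f (machines_A m) + sum f (machines_B m) = sum f {1..m}"
  unfolding machines_AB_Un[symmetric]
  by (rule sum.union_disjoint[symmetric]) (simp_all add: finite_machines machines_AB_disjoint)

section \<open>Lower bounds and machine counts of a fixed job sequence\<close>

locale job_sequence =
  fixes m n :: nat and p :: "nat \<Rightarrow> real"
  assumes m: "2 \<le> m" and pos: "\<forall>i\<in>{1..n}. 0 < p i"
begin

abbreviation LB :: "nat \<Rightarrow> real" where "LB \<equiv> lower_bound m p"

lemma LB_nonneg: "t \<le> n \<Longrightarrow> 0 \<le> LB t"
  using pos by (intro lower_bound_nonneg) auto

lemma LB_bounds: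
  assumes "t \<le> n"
  shows "(\<Sum>i=1..t. p i) \<le> real m * LB t" and "i \<in> {1..t} \<Longrightarrow> p i \<le> LB t"
    and "card {i\<in>{1..t}. p i > LB t / 2} \<le> m"
  using lower_bound_le_iff[of m "LB t" p t] m LB_nonneg[OF assms] by auto

text \<open>Each of the three conditions of \<open>lower_bound_le_iff\<close> for
  \<open>LB t\<close> passes to the shorter sequence.\<close>

lemma LB_mono:
  assumes "s \<le> t" and "t \<le> n"
  shows "LB s \<le> LB t"
proof -
  have "(\<Sum>i=1..s. p i) \<le> (\<Sum>i=1..t. p i)"
    using assms pos by (intro sum_mono2) (auto simp: less_imp_le)
  moreover have "card {i\<in>{1..s}. p i > LB t / 2} \<le> card {i\<in>{1..t}. p i > LB t / 2}"
    using assms by (intro card_mono) auto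
  moreover have "p i \<le> LB t" if "i \<in> {1..s}" for i
    using LB_bounds(2)[OF assms(2), of i] that assms(1) by auto
  ultimately show ?thesis
    using lower_bound_le_iff[of m "LB t" p s] m LB_nonneg[OF assms(2)] LB_bounds[OF assms(2)] by force
qed

lemma half_machines:
  "real m = real (card (machines_A m)) + real (card (machines_B m))"
  "1 \<le> real (card (machines_A m))"
  "real (card (machines_A m)) \<le> real (card (machines_B m))"
  "real (card (machines_B m)) \<le> real (card (machines_A m)) + 1"
proof -
  have "m = m div 2 + (m - m div 2)" "1 \<le> m div 2" "m div 2 \<le> m - m div 2"
    "m - m div 2 \<le> m div 2 + 1"
    using m by auto
  then show "real m = real (card (machines_A m)) + real (card (machines_B m))"
    "1 \<le> real (card (machines_A m))"
    "real (card (machines_A m)) \<le> real (card (machines_B m))"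
    "real (card (machines_B m)) \<le> real (card (machines_A m)) + 1"
    unfolding card_machines by linarith+
qed

section \<open>Loads during the arrival phase\<close>

lemma arrival_dom:
  assumes "arrival c m p t \<sigma>"
  shows "dom \<sigma> = {1..t}" and "ran \<sigma> \<subseteq> {1..m}" and "finite (dom \<sigma>)" and "finite (jobs \<sigma> j)"
proof -
  show "dom \<sigma> = {1..t}" "ran \<sigma> \<subseteq> {1..m}"
    using arrival_schedule[OF assms] by (auto simp: schedules_def)
  then show "finite (dom \<sigma>)" by simp
  then show "finite (jobs \<sigma> j)" by (rule finite_subset[rotated]) auto
qed

lemma arrival_nonneg:
  assumes "arrival c m p t \<sigma>" and "t \<le> n" and "i \<in> dom \<sigma>"
  shows "0 \<le> p i"
  using arrival_dom(1)[OF assms(1)] assms pos by (auto simp: less_imp_le)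

lemma sum_load_arrival:
  assumes "arrival c m p t \<sigma>"
  shows "sum (load p \<sigma>) (machines_A m) + sum (load p \<sigma>) (machines_B m) = (\<Sum>i=1..t. p i)"
  unfolding sum_machines using sum_load[OF arrival_dom(3,2)[OF assms]] arrival_dom(1)[OF assms] by simp

text \<open>What \<open>b\<close> holds without \<open>q\<close> is at most its load before its last
  assignment, and averaging the volume of that time bounds the latter. The second claim uses half of
  the remaining load because the lower bound of that time may be far below
  \<open>LB n\<close>.\<close>

lemma load_B_without_largest:
  assumes \<sigma>: "arrival (5/3) m p n \<sigma>" and b: "b \<in> machines_B m" and q: "largest_job p \<sigma> b q"
  shows "load p \<sigma> b - p q \<le> 4/3 * LB n"
    and "load p \<sigma> b - p q \<le> 2/3 * LB n \<or>
      (\<forall>a\<in>machines_A m. (load p \<sigma> b - p q) / 2 \<le> small_load (5/3) m p n \<sigma> a)"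
proof -
  obtain t \<sigma>\<^sub>0 where t: "t < n" and \<sigma>0: "arrival (5/3) m p t \<sigma>\<^sub>0"
    and choice: "arrival_choice (5/3) m p (Suc t) \<sigma>\<^sub>0 b" and le: "\<sigma>\<^sub>0 \<subseteq>\<^sub>m \<sigma>"
    and jobs_b: "jobs \<sigma> b = insert (Suc t) (jobs \<sigma>\<^sub>0 b)"
    using arrival_last_assignment[OF \<sigma> largest_job_in[OF q]] by blast
  define f g where "f = real (card (machines_A m))" and "g = real (card (machines_B m))"
  have fg: "real m = f + g" "1 \<le> f" "f \<le> g" "g \<le> f + 1"
    using half_machines by (simp_all add: f_def g_def)
  let ?L = "LB (Suc t)" and ?l = "load p \<sigma>\<^sub>0 b"
  have L: "0 \<le> ?L" "?L \<le> LB n" using LB_nonneg LB_mono t by simp_all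
  have bA: "b \<notin> machines_A m" using b machines_AB_disjoint by blast
  have "Suc t \<notin> dom \<sigma>\<^sub>0" by (simp add: arrival_dom(1)[OF \<sigma>0] del: domIff)
  then have "Suc t \<notin> jobs \<sigma>\<^sub>0 b" by auto
  then have "load p \<sigma> b = p (Suc t) + ?l"
    unfolding load_def jobs_b using arrival_dom(4)[OF \<sigma>0] by simp
  moreover have "\<sigma> (Suc t) = Some b" using jobs_b by blast
  ultimately have y: "load p \<sigma> b - p q \<le> ?l" using largest_job_ge[OF q] by fastforce
  have nn: "i \<in> dom \<sigma>\<^sub>0 \<Longrightarrow> 0 \<le> p i" for i using arrival_nonneg[OF \<sigma>0] t by simp
  have vol: "sum (load p \<sigma>\<^sub>0) (machines_A m) + sum (load p \<sigma>\<^sub>0) (machines_B m) + p (Suc t) \<le> (f + g) * ?L"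
    using sum_load_arrival[OF \<sigma>0] LB_bounds(1)[of "Suc t"] t fg(1) by simp
  have pt: "0 < p (Suc t)" using pos t by simp
  show "load p \<sigma> b - p q \<le> 4/3 * LB n" and "load p \<sigma> b - p q \<le> 2/3 * LB n \<or>
      (\<forall>a\<in>machines_A m. (load p \<sigma> b - p q) / 2 \<le> small_load (5/3) m p n \<sigma> a)"
  proof (atomize (full), cases "small_at (5/3) m p (Suc t) (Suc t)")
    case True
    then have empty: "{a \<in> machines_A m. small_load (5/3) m p (Suc t) \<sigma>\<^sub>0 a \<le> 2/3 * ?L} = {}"
      and ll: "least_loaded (load p \<sigma>\<^sub>0) (machines_B m) b"
      using choice bA unfolding arrival_choice_def Let_def
      by (auto split: if_splits dest!: least_loaded_in)
    have sm: "small_load (5/3) m p (Suc t) \<sigma>\<^sub>0 a \<le> load p \<sigma>\<^sub>0 a" for a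
      unfolding small_load_def using arrival_dom(3)[OF \<sigma>0] nn by (rule sum_le_load) auto
    have full: "2/3 * ?L \<le> small_load (5/3) m p (Suc t) \<sigma>\<^sub>0 a" if "a \<in> machines_A m" for a
      using empty that by (auto simp: not_le less_imp_le)
    have "f * (2/3 * ?L) \<le> sum (load p \<sigma>\<^sub>0) (machines_A m)" unfolding f_def
      using order_trans[OF full sm] by (intro sum_bounded_below)
    moreover have "g * ?l \<le> sum (load p \<sigma>\<^sub>0) (machines_B m)" unfolding g_def
      using least_loaded_le[OF ll] by (intro sum_bounded_below) simp
    \<comment> \<open>The machines of \<open>A\<close> leave at most
      \<open>g * ?L + f / 3 * ?L\<close> to \<open>B\<close>; with \<open>f\<close> at most
      \<open>g\<close> this averages to 4/3.\<close>
    moreover have "f * ?L \<le> g * ?L" using fg L by (intro mult_right_mono)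
    ultimately have "g * ?l \<le> g * (4/3 * ?L)" using vol pt by (simp add: algebra_simps)
    then have l: "?l \<le> 4/3 * ?L" using fg by simp
    moreover have "2/3 * ?L \<le> small_load (5/3) m p n \<sigma> a" if "a \<in> machines_A m" for a
    proof -
      \<comment> \<open>Jobs stay on their machine and small jobs stay small as the lower bound
        grows.\<close>
      have "small_load (5/3) m p (Suc t) \<sigma>\<^sub>0 a \<le> small_load (5/3) m p n \<sigma> a"
        unfolding small_load_def small_at_5_3
      proof (rule sum_mono2)
        show "finite {i. \<sigma> i = Some a \<and> p i \<le> LB n / 3}"
          by (rule finite_subset[OF _ arrival_dom(4)[OF \<sigma>, of a]]) auto
        show "{i. \<sigma>\<^sub>0 i = Some a \<and> p i \<le> ?L / 3} \<subseteq> {i. \<sigma> i = Some a \<and> p i \<le> LB n / 3}"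
          using le L by (force simp: map_le_def)
      qed (use arrival_nonneg[OF \<sigma> order_refl] in blast)
      then show ?thesis using full[OF that] by linarith
    qed
    ultimately show "load p \<sigma> b - p q \<le> 4/3 * LB n \<and> (load p \<sigma> b - p q \<le> 2/3 * LB n \<or>
      (\<forall>a\<in>machines_A m. (load p \<sigma> b - p q) / 2 \<le> small_load (5/3) m p n \<sigma> a))"
      using y L by fastforce
  next
    case False
    then have empty: "\<not> (\<exists>a\<in>machines_A m. load p \<sigma>\<^sub>0 a \<le> 4/3 * ?L)"
      and ll: "least_loaded (load p \<sigma>\<^sub>0) (machines_B m) b"
      using choice bA unfolding arrival_choice_def Let_def
      by (auto split: if_splits dest!: least_loaded_in)
    have "f * (4/3 * ?L) \<le> sum (load p \<sigma>\<^sub>0) (machines_A m)" unfolding f_def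
      using empty by (intro sum_bounded_below) force
    moreover have "g * ?l \<le> sum (load p \<sigma>\<^sub>0) (machines_B m)" unfolding g_def
      using least_loaded_le[OF ll] by (intro sum_bounded_below) simp
    \<comment> \<open>The machines of \<open>A\<close> leave at most \<open>(g - f / 3) * ?L\<close>
      to \<open>B\<close>, and the arriving large job takes another \<open>?L / 3\<close>. As
      \<open>g\<close> is at most \<open>f + 1\<close>, at most \<open>2/3 * g * ?L\<close> remains,
      even for odd \<open>m\<close>.\<close>
    moreover have "g * ?L \<le> (f + 1) * ?L" using fg L by (intro mult_right_mono)
    moreover have "?L / 3 < p (Suc t)" using False by (simp add: small_at_5_3)
    ultimately have "g * ?l \<le> g * (2/3 * ?L)" using vol by (simp add: algebra_simps)
    then have l: "?l \<le> 2/3 * ?L" using fg by simp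
    then show "load p \<sigma> b - p q \<le> 4/3 * LB n \<and> (load p \<sigma> b - p q \<le> 2/3 * LB n \<or>
      (\<forall>a\<in>machines_A m. (load p \<sigma> b - p q) / 2 \<le> small_load (5/3) m p n \<sigma> a))"
      using y L by linarith
  qed
qed

text \<open>The count is carried along because a small arrival turns exactly these jobs into the set
  \<open>H\<close> of \<open>after_small\<close>. A growing lower bound can only decrease
  it.\<close>

lemma arrival_A_invariant:
  assumes "arrival (5/3) m p t \<sigma>" and "t \<le> n" and "a \<in> machines_A m"
  shows "A_invariant p (jobs \<sigma> a) (LB t) \<and> card {i\<in>jobs \<sigma> a. LB t / 3 < p i} \<le> 4"
  using assms(1,2)
proof (induction rule: arrival.induct)
  case start
  then show ?case using A_invariant_empty LB_nonneg by simp
next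
  case (assign t \<sigma> j)
  let ?L = "LB (Suc t)" and ?X = "jobs \<sigma> a"
  have L: "0 \<le> ?L" "LB t \<le> ?L" using LB_nonneg LB_mono assign.prems by simp_all
  have fin: "finite ?X" by (rule arrival_dom(4)[OF assign(1)])
  have "Suc t \<notin> dom \<sigma>" by (simp add: arrival_dom(1)[OF assign(1)] del: domIff)
  then have new: "Suc t \<notin> ?X" and None: "\<sigma> (Suc t) = None" by auto
  have nn: "0 \<le> p i" if "i \<in> dom \<sigma>" for i
    using arrival_nonneg[OF assign(1) _ that] assign.prems by simp
  have inv: "A_invariant p ?X ?L" using A_invariant_mono[OF _ L(2)] assign by simp
  have "card {i\<in>?X. ?L / 3 < p i} \<le> card {i\<in>?X. LB t / 3 < p i}"
    using fin L by (intro card_mono) auto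
  then have four: "card {i\<in>?X. ?L / 3 < p i} \<le> 4" using assign by simp
  show ?case
  proof (cases "j = a")
    case False
    have "jobs (\<sigma>(Suc t \<mapsto> j)) a = ?X" using False None by auto
    then show ?thesis using inv four by simp
  next
    case True
    then have X: "jobs (\<sigma>(Suc t \<mapsto> j)) a = insert (Suc t) ?X" by auto
    have aB: "a \<notin> machines_B m" using assms(3) machines_AB_disjoint by blast
    have choice: "arrival_choice (5/3) m p (Suc t) \<sigma> a" using assign(2) True by simp
    show ?thesis
    proof (cases "small_at (5/3) m p (Suc t) (Suc t)")
      case small: True
      then have "small_load (5/3) m p (Suc t) \<sigma> a \<le> 2/3 * ?L"
        using choice aB unfolding arrival_choice_def Let_def
        by (auto split: if_splits dest!: least_loaded_in)
      then have "sum p {k\<in>?X. p k \<le> ?L / 3} \<le> 2/3 * ?L"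
        by (simp add: small_load_def small_at_5_3)
      moreover have "p k \<le> ?L" if "k \<in> ?X" for k
      proof -
        have "k \<in> dom \<sigma>" using that by blast
        then have "k \<in> {1..Suc t}" using arrival_dom(1)[OF assign(1)] by simp
        then show ?thesis by (rule LB_bounds(2)[OF assign.prems])
      qed
      moreover have "p (Suc t) \<le> ?L / 3" using small by (simp add: small_at_5_3)
      ultimately have "A_invariant p (insert (Suc t) ?X) ?L"
        using A_invariant_small[OF fin new L(1)] four by blast
      moreover have "{i \<in> insert (Suc t) ?X. ?L / 3 < p i} = {i\<in>?X. ?L / 3 < p i}"
        using \<open>p (Suc t) \<le> ?L / 3\<close> by auto
      ultimately show ?thesis using four X by simp
    next
      case large: False
      then obtain a' where a': "a' \<in> machines_A m" "load p \<sigma> a' \<le> 4/3 * ?L"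
        and ll: "least_loaded (load p \<sigma>) (machines_A m) a"
        using choice aB unfolding arrival_choice_def Let_def
        by (auto split: if_splits dest!: least_loaded_in)
      have load: "sum p ?X \<le> 4/3 * ?L"
        using least_loaded_le[OF ll a'(1)] a'(2) by (simp add: load_def)
      have pt: "?L / 3 < p (Suc t)" using large by (simp add: small_at_5_3)
      let ?H = "{i\<in>?X. ?L / 3 < p i}"
      \<comment> \<open>Four jobs above \<open>?L / 3\<close> would exceed the load
        \<open>4/3 * ?L\<close> up to which a large job is accepted.\<close>
      have "card ?H \<le> 3"
      proof (rule ccontr)
        assume "\<not> card ?H \<le> 3"
        then have "?H \<noteq> {}" "4 \<le> real (card ?H)" by (auto simp del: Collect_empty_eq)
        have "finite ?H" using fin by simp
        have "4 * (?L / 3) \<le> real (card ?H) * (?L / 3)"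
          using L \<open>4 \<le> real (card ?H)\<close> by (intro mult_right_mono) auto
        also have "\<dots> < sum p ?H"
          using sum_strict_mono[OF \<open>finite ?H\<close> \<open>?H \<noteq> {}\<close>, of "\<lambda>_. ?L / 3" p] by simp
        also have "\<dots> \<le> sum p ?X" using fin nn by (intro sum_mono2) auto
        finally show False using load by simp
      qed
      moreover have "{i \<in> insert (Suc t) ?X. ?L / 3 < p i} = insert (Suc t) ?H" using pt by auto
      ultimately have "card {i \<in> insert (Suc t) ?X. ?L / 3 < p i} \<le> 4"
        using fin by (simp add: card_insert_if)
      then show ?thesis using A_invariant_large[OF inv fin new pt load] X by simp
    qed
  qed
qed

section \<open>The migration phase\<close>

lemma remove_A_schedule:
  assumes "remove_A c m p L \<sigma> R \<sigma>' R'"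
  shows "\<sigma>' \<subseteq>\<^sub>m \<sigma>" and "j \<notin> machines_A m \<Longrightarrow> jobs \<sigma>' j = jobs \<sigma> j"
    and "j \<in> machines_A m \<Longrightarrow> load p \<sigma>' j \<le> (c - 1) * L"
    and "R \<inter> dom \<sigma> = {} \<Longrightarrow> R' \<inter> dom \<sigma>' = {}"
  using assms
proof (atomize (full), induction rule: remove_A.induct)
  case (remove k \<sigma> i R \<sigma>' R')
  have i: "\<sigma> i = Some k" by (rule largest_job_in[OF remove.hyps(3)])
  have le: "\<sigma>(i := None) \<subseteq>\<^sub>m \<sigma>" by (auto simp: map_le_def)
  have jobs: "jobs (\<sigma>(i := None)) j = jobs \<sigma> j" if "j \<notin> machines_A m"
    using i that remove.hyps(1) by auto
  have dis: "insert i R \<inter> dom (\<sigma>(i := None)) = {}" if "R \<inter> dom \<sigma> = {}" using that by auto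
  show ?case using remove.IH map_le_trans[OF _ le] jobs dis by (simp del: fun_upd_apply)
qed auto

text \<open>The small load of \<open>a\<close> drops only if its largest job is small. Then all its
  jobs are small, their sum exceeds \<open>2/3 * L\<close>, and more than \<open>L / 3\<close>
  stays.\<close>

lemma remove_A_small_load:
  assumes "remove_A (5/3) m p L \<sigma> R \<sigma>' R'" and "finite (dom \<sigma>)" and "\<forall>i\<in>dom \<sigma>. 0 \<le> p i"
    and "a \<in> machines_A m" and "L / 3 \<le> (\<Sum>i | \<sigma> i = Some a \<and> p i \<le> L / 3. p i)"
  shows "L / 3 \<le> load p \<sigma>' a"
  using assms
proof (induction rule: remove_A.induct)
  case (stop \<sigma> R)
  have "(\<Sum>i | \<sigma> i = Some a \<and> p i \<le> L / 3. p i) \<le> load p \<sigma> a"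
    using stop.prems(1,2) by (intro sum_le_load) auto
  then show ?case using stop.prems by linarith
next
  case (remove k \<sigma> i R \<sigma>' R')
  let ?\<sigma> = "\<sigma>(i := None)"
  let ?S = "\<lambda>\<sigma>. {i. \<sigma> i = Some a \<and> p i \<le> L / 3}"
  have i: "\<sigma> i = Some k" by (rule largest_job_in[OF remove.hyps(3)])
  have "L / 3 \<le> sum p (?S ?\<sigma>)"
  proof (cases "k = a \<and> p i \<le> L / 3")
    case False
    then have "?S ?\<sigma> = ?S \<sigma>" using i by auto
    then show ?thesis using remove.prems(4) by simp
  next
    case True
    have fin: "finite (jobs \<sigma> a)" by (rule finite_subset[OF _ remove.prems(1)]) auto
    have "?S ?\<sigma> = jobs \<sigma> a - {i}"
      using True largest_job_ge[OF remove.hyps(3)] by force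
    moreover have "sum p (jobs \<sigma> a - {i}) = sum p (jobs \<sigma> a) - p i"
      using fin i True by (simp add: sum_diff1)
    moreover have "2/3 * L < sum p (jobs \<sigma> a)" using remove.hyps(2) True by (simp add: load_def)
    ultimately show ?thesis using True by simp
  qed
  moreover have "finite (dom ?\<sigma>)" "\<forall>i\<in>dom ?\<sigma>. 0 \<le> p i" using remove.prems(1,2) by auto
  ultimately show ?case using remove.IH remove.prems(3) by blast
qed

text \<open>The second alternative for \<open>g\<close> describes a machine that has received a job:
  reassignment runs in non-increasing order, so that job is at least as large as
  \<open>i\<close>.\<close>

lemma reassigned_job_fits:
  fixes g :: "nat \<Rightarrow> real" \<comment> \<open>loads after the removal step\<close>
  assumes dom: "dom \<sigma> \<subseteq> {1..n}" and ran: "ran \<sigma> \<subseteq> {1..m}" and i: "i \<in> {1..n}" "i \<notin> dom \<sigma>"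
    and g: "\<forall>j\<in>{1..m}. load p \<sigma> j = g j \<or>
      (\<exists>k. \<sigma> k = Some j \<and> p i \<le> p k \<and> g j + p k \<le> load p \<sigma> j)"
    and gA: "\<forall>a\<in>machines_A m. g a \<le> 2/3 * LB n"
    and gB: "\<forall>b\<in>machines_B m. 2/3 * LB n < g b \<longrightarrow> (\<forall>a\<in>machines_A m. LB n / 3 \<le> g a)"
    and B: "\<forall>b\<in>machines_B m. 5/3 * LB n < load p \<sigma> b + p i"
    and a: "least_loaded (load p \<sigma>) (machines_A m) a"
  shows "load p \<sigma> a + p i \<le> 5/3 * LB n"
proof (rule ccontr)
  let ?L = "LB n"
  assume "\<not> ?thesis"
  then have A: "5/3 * ?L < load p \<sigma> j + p i" if "j \<in> machines_A m" for j
    using least_loaded_le[OF a that] by linarith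
  then have AB: "5/3 * ?L < load p \<sigma> j + p i" if "j \<in> {1..m}" for j
    using B that machines_AB_Un by blast
  have fin: "finite (dom \<sigma>)" using dom finite_subset by blast
  have pi: "0 < p i" "p i \<le> ?L" using i pos LB_bounds(2)[of n i] by auto
  have "(\<Sum>j\<in>{1..m}. load p \<sigma> j) + p i = sum p (insert i (dom \<sigma>))"
    using sum_load[OF fin ran] fin i by simp
  also have "\<dots> \<le> (\<Sum>i=1..n. p i)"
    using dom i pos by (intro sum_mono2) (auto simp: less_imp_le)
  also have "\<dots> \<le> real m * ?L" by (rule LB_bounds(1)) simp
  finally have vol: "(\<Sum>j\<in>{1..m}. load p \<sigma> j) + p i \<le> real m * ?L" .
  have big: "2/3 * ?L < p i"
  proof (rule ccontr)
    assume "\<not> 2/3 * ?L < p i"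
    \<comment> \<open>Every machine would have load at least \<open>?L\<close>, and the job
      \<open>i\<close> on top would exceed the volume.\<close>
    then have "?L \<le> load p \<sigma> j" if "j \<in> {1..m}" for j using AB[OF that] by linarith
    then have "real (card {1..m}) * ?L \<le> (\<Sum>j\<in>{1..m}. load p \<sigma> j)" by (intro sum_bounded_below)
    then show False using vol pi by simp
  qed
  have reassigned_A: "\<exists>k. \<sigma> k = Some j \<and> p i \<le> p k \<and> g j + p k \<le> load p \<sigma> j"
    if "j \<in> machines_A m" for j
  proof -
    \<comment> \<open>A machine of \<open>A\<close> without a reassigned job has load at most
      \<open>2/3 * ?L\<close>, so \<open>i\<close> would fit there.\<close>
    have "load p \<sigma> j \<noteq> g j" using A[OF that] gA that pi by force
    then show ?thesis using g that machines_AB_Un by blast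
  qed
  \<comment> \<open>Otherwise \<open>i\<close> and one job per machine would be \<open>m + 1\<close>
    jobs above \<open>?L / 2\<close>.\<close>
  have "\<not> (\<forall>j\<in>{1..m}. \<exists>k. \<sigma> k = Some j \<and> ?L / 2 < p k)"
  proof
    assume "\<forall>j\<in>{1..m}. \<exists>k. \<sigma> k = Some j \<and> ?L / 2 < p k"
    then obtain \<kappa> where \<kappa>: "\<forall>j\<in>{1..m}. \<sigma> (\<kappa> j) = Some j \<and> ?L / 2 < p (\<kappa> j)" by metis
    then have "inj_on \<kappa> {1..m}" by (intro inj_onI) (metis option.inject)
    moreover have notin: "i \<notin> \<kappa> ` {1..m}" using \<kappa> i(2) by auto
    ultimately have "card (insert i (\<kappa> ` {1..m})) = Suc m" by (simp add: card_image)
    moreover have "\<kappa> ` {1..m} \<subseteq> {1..n}" using \<kappa> dom by blast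
    then have "insert i (\<kappa> ` {1..m}) \<subseteq> {k\<in>{1..n}. p k > ?L / 2}"
      using \<kappa> i big pi by auto
    then have "card (insert i (\<kappa> ` {1..m})) \<le> card {k\<in>{1..n}. p k > ?L / 2}"
      by (intro card_mono) auto
    ultimately show False using LB_bounds(3)[of n] by simp
  qed
  then obtain b where b: "b \<in> {1..m}" "\<And>k. \<sigma> k = Some b \<Longrightarrow> p k \<le> ?L / 2" by force
  have no: "\<not> p i \<le> p k" if "\<sigma> k = Some b" for k using b(2)[OF that] big pi by linarith
  have "b \<notin> machines_A m" using reassigned_A no by blast
  then have bB: "b \<in> machines_B m" using b(1) machines_AB_Un by blast
  have "load p \<sigma> b = g b" using g b(1) no by blast
  then have "2/3 * ?L < g b" using B bB pi by force
  then have gA': "\<forall>a\<in>machines_A m. ?L / 3 \<le> g a" using gB bB by blast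
  have A': "?L / 3 + p i \<le> load p \<sigma> j" if "j \<in> machines_A m" for j
    using reassigned_A[OF that] gA' that by fastforce
  define f h where "f = real (card (machines_A m))" and "h = real (card (machines_B m))"
  have fh: "real m = f + h" "h = f \<or> h = f + 1"
    using half_machines by (simp_all add: f_def h_def) linarith
  have "f * (?L / 3 + p i) \<le> sum (load p \<sigma>) (machines_A m)"
    unfolding f_def using A' by (intro sum_bounded_below)
  moreover have "h * (5/3 * ?L - p i) < sum (load p \<sigma>) (machines_B m)"
  proof -
    have "(\<Sum>b\<in>machines_B m. 5/3 * ?L - p i) < sum (load p \<sigma>) (machines_B m)"
      by (rule sum_strict_mono) (use B finite_machines bB in \<open>auto simp: algebra_simps\<close>)
    then show ?thesis by (simp add: h_def)
  qed
  \<comment> \<open>The left side is \<open>2 * f * ?L + p i\<close> if \<open>h = f\<close>, and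
    \<open>(2 * f + 5/3) * ?L\<close> if \<open>h = f + 1\<close>; neither is below
    \<open>(f + h) * ?L\<close>.\<close>
  ultimately have "f * (?L / 3 + p i) + h * (5/3 * ?L - p i) + p i < (f + h) * ?L"
    using vol sum_machines[of "load p \<sigma>" m] fh(1) by simp
  then show False using fh(2) pi by (auto simp: field_simps)
qed

text \<open>Here \<open>k\<close> dominates all jobs still to be placed, which survives each step;
  \<open>reassigned_job_fits\<close> asks this only for the next job.\<close>

lemma reassign_load:
  fixes g :: "nat \<Rightarrow> real"
  assumes "reassign (5/3) m p (LB n) xs \<sigma> \<sigma>'"
    and "dom \<sigma> \<union> set xs \<subseteq> {1..n}" and "dom \<sigma> \<inter> set xs = {}" and "ran \<sigma> \<subseteq> {1..m}"
    and "distinct xs" and "sorted_wrt (\<lambda>i k. p i \<ge> p k) xs"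
    and "\<forall>j\<in>{1..m}. load p \<sigma> j \<le> 5/3 * LB n"
    and "\<forall>j\<in>{1..m}. load p \<sigma> j = g j \<or>
      (\<exists>k. \<sigma> k = Some j \<and> (\<forall>i\<in>set xs. p i \<le> p k) \<and> g j + p k \<le> load p \<sigma> j)"
    and gA: "\<forall>a\<in>machines_A m. g a \<le> 2/3 * LB n"
    and gB: "\<forall>b\<in>machines_B m. 2/3 * LB n < g b \<longrightarrow> (\<forall>a\<in>machines_A m. LB n / 3 \<le> g a)"
  shows "\<forall>j\<in>{1..m}. load p \<sigma>' j \<le> 5/3 * LB n"
  using assms(1-8)
proof (induction rule: reassign.induct)
  case (step \<sigma> i j xs \<sigma>')
  let ?\<sigma> = "\<sigma>(i \<mapsto> j)"
  have i: "i \<in> {1..n}" "i \<notin> dom \<sigma>" using step.prems by auto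
  have dom: "dom \<sigma> \<subseteq> {1..n}" using step.prems by auto
  have nn: "0 \<le> p k" if "k \<in> {1..n}" for k using that pos by (auto simp: less_imp_le)
  have j: "j \<in> {1..m}"
    using step.hyps(1) unfolding machines_AB[symmetric] reassign_choice_def
    by (auto split: if_splits dest!: least_loaded_in)
  have fits: "load p \<sigma> j + p i \<le> 5/3 * LB n"
  proof (cases "\<exists>j\<in>machines_B m. load p \<sigma> j + p i \<le> 5/3 * LB n")
    case True
    then show ?thesis using step.hyps(1) by (simp add: reassign_choice_def)
  next
    case False
    then have B: "\<forall>b\<in>machines_B m. 5/3 * LB n < load p \<sigma> b + p i" by force
    have g: "\<forall>j\<in>{1..m}. load p \<sigma> j = g j \<or>
      (\<exists>k. \<sigma> k = Some j \<and> p i \<le> p k \<and> g j + p k \<le> load p \<sigma> j)"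
      using step.prems(7) by (meson list.set_intros(1))
    have "least_loaded (load p \<sigma>) (machines_A m) j"
      using step.hyps(1) False by (simp add: reassign_choice_def)
    then show ?thesis
      by (rule reassigned_job_fits[OF dom step.prems(3) i g gA gB B])
  qed
  have load: "load p ?\<sigma> k = (if k = j then load p \<sigma> k + p i else load p \<sigma> k)" for k
  proof (cases "k = j")
    case True
    then have "jobs ?\<sigma> k = insert i (jobs \<sigma> k)" by auto
    moreover have "finite (jobs \<sigma> k)"
      by (rule finite_subset[of _ "{1..n}"]) (use dom in auto)
    moreover have "i \<notin> jobs \<sigma> k" using i by auto
    ultimately show ?thesis using True by (simp add: load_def del: fun_upd_apply)
  next
    case False
    then have "jobs ?\<sigma> k = jobs \<sigma> k" using i by auto
    then show ?thesis using False by (simp add: load_def del: fun_upd_apply)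
  qed
  have g: "load p ?\<sigma> l = g l \<or>
      (\<exists>k. ?\<sigma> k = Some l \<and> (\<forall>i\<in>set xs. p i \<le> p k) \<and> g l + p k \<le> load p ?\<sigma> l)"
    if "l \<in> {1..m}" for l
  proof -
    note l = that
    consider "load p \<sigma> l = g l" | k where "\<sigma> k = Some l" "\<forall>i\<in>set xs. p i \<le> p k" "g l + p k \<le> load p \<sigma> l"
      using bspec[OF step.prems(7) l] by (elim disjE exE conjE) auto
    note cases = this
    show ?thesis
    proof (cases "l = j")
      case True
      \<comment> \<open>The job \<open>i\<close> becomes the witness of its machine even if an
        earlier job had that role; of the earlier one only this inequality is kept.\<close>
      have "g l \<le> load p \<sigma> l"
      proof (cases rule: cases)
        case (2 k)
        then have "0 \<le> p k" using dom nn by blast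
        then show ?thesis using 2 by simp
      qed simp
      then have "g l + p i \<le> load p ?\<sigma> l" using load True by simp
      moreover have "\<forall>k\<in>set xs. p k \<le> p i" using step.prems(5) by simp
      ultimately show ?thesis using True by (intro disjI2 exI[of _ i]) simp
    next
      case False
      show ?thesis
      proof (cases rule: cases)
        case 1
        then show ?thesis using load False by simp
      next
        case (2 k)
        then have "k \<noteq> i" using i by auto
        then show ?thesis using 2 load False by (intro disjI2 exI[of _ k]) simp
      qed
    qed
  qed
  show ?case
  proof (rule step.IH)
    show "dom ?\<sigma> \<union> set xs \<subseteq> {1..n}" "dom ?\<sigma> \<inter> set xs = {}" using step.prems by auto
    show "ran ?\<sigma> \<subseteq> {1..m}" using step.prems(3) j i by (auto simp: ran_def split: if_splits)
    show "\<forall>j\<in>{1..m}. load p ?\<sigma> j \<le> 5/3 * LB n" using load fits step.prems(6) by simp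
    show "\<forall>j\<in>{1..m}. load p ?\<sigma> j = g j \<or>
      (\<exists>k. ?\<sigma> k = Some j \<and> (\<forall>i\<in>set xs. p i \<le> p k) \<and> g j + p k \<le> load p ?\<sigma> j)"
      using g by blast
  qed (use step.prems in auto)
qed simp

section \<open>Combination of the phases\<close>

lemma ALG_guarantees:
  assumes "ALG (5/3) m p n \<sigma>' R"
  shows "makespan m p \<sigma>' \<le> 5/3 * LB n" and "card R \<le> 4 * m"
proof -
  obtain \<sigma> R\<^sub>B \<sigma>\<^sub>R xs where \<sigma>: "arrival (5/3) m p n \<sigma>" and RB: "remove_B m p \<sigma> R\<^sub>B"
    and rem: "remove_A (5/3) m p (LB n) (\<sigma> |` (- R\<^sub>B)) R\<^sub>B \<sigma>\<^sub>R R"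
    and xs: "distinct xs" "set xs = R" "sorted_wrt (\<lambda>i k. p i \<ge> p k) xs"
    and re: "reassign (5/3) m p (LB n) xs \<sigma>\<^sub>R \<sigma>'"
    using assms unfolding ALG_def by blast
  let ?\<sigma> = "\<sigma> |` (- R\<^sub>B)"
  note dom = arrival_dom[OF \<sigma>]
  have L: "0 \<le> LB n" using LB_nonneg by simp
  obtain r where r: "\<forall>j \<in> machines_B m \<inter> ran \<sigma>. largest_job p \<sigma> j (r j)"
    and RBr: "R\<^sub>B = r ` (machines_B m \<inter> ran \<sigma>)"
    using RB unfolding remove_B_def by blast
  have finRB: "finite R\<^sub>B" using RBr finite_machines by simp
  have jobsA: "jobs ?\<sigma> a = jobs \<sigma> a" if a: "a \<in> machines_A m" for a
  proof -
    have "i \<notin> R\<^sub>B" if "\<sigma> i = Some a" for i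
      using that r largest_job_in a machines_AB_disjoint[of m] unfolding RBr by fastforce
    then show ?thesis by (auto simp: restrict_map_def)
  qed
  have fin: "finite (dom ?\<sigma>)" using dom(3) by simp
  have "card R \<le> card R\<^sub>B + sum (\<lambda>_. 7) (machines_A m)"
  proof (rule card_remove_A_le[OF rem fin finRB], intro ballI)
    fix a assume a: "a \<in> machines_A m"
    show "excess_at_most p (jobs ?\<sigma> a) ((5/3 - 1) * LB n) 7"
      using A_invariant_excess[OF conjunct1[OF arrival_A_invariant[OF \<sigma> order_refl a]] dom(4) L]
      by (simp add: jobsA[OF a])
  qed
  moreover have "card R\<^sub>B \<le> card (machines_B m)"
  proof -
    have "card R\<^sub>B \<le> card (machines_B m \<inter> ran \<sigma>)"
      unfolding RBr by (rule card_image_le) (simp add: finite_machines)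
    also have "\<dots> \<le> card (machines_B m)" by (rule card_mono) (auto simp: finite_machines)
    finally show ?thesis .
  qed
  \<comment> \<open>\<open>7 * (m div 2) + (m - m div 2)\<close> equals
    \<open>m + 6 * (m div 2)\<close>, which is at most \<open>4 * m\<close>.\<close>
  ultimately show "card R \<le> 4 * m" unfolding card_machines by (simp add: card_machines)
  have le: "\<sigma>\<^sub>R \<subseteq>\<^sub>m \<sigma>"
  proof (rule map_le_trans)
    show "\<sigma>\<^sub>R \<subseteq>\<^sub>m ?\<sigma>" by (rule remove_A_schedule(1)[OF rem])
    show "?\<sigma> \<subseteq>\<^sub>m \<sigma>" by (auto simp: map_le_def restrict_map_def)
  qed
  have A: "load p \<sigma>\<^sub>R a \<le> 2/3 * LB n" if "a \<in> machines_A m" for a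
    using remove_A_schedule(3)[OF rem that] by simp
  have B: "load p \<sigma>\<^sub>R b \<le> 4/3 * LB n \<and> (2/3 * LB n < load p \<sigma>\<^sub>R b \<longrightarrow>
      (\<forall>a\<in>machines_A m. LB n / 3 \<le> load p \<sigma>\<^sub>R a))" if b: "b \<in> machines_B m" for b
  proof (cases "b \<in> ran \<sigma>")
    case False
    have "b \<notin> machines_A m" using b machines_AB_disjoint by blast
    then have "jobs \<sigma>\<^sub>R b = jobs ?\<sigma> b" by (rule remove_A_schedule(2)[OF rem])
    also have "\<dots> = {}" using False by (auto simp: ran_def restrict_map_def)
    finally show ?thesis using L by (simp add: load_def)
  next
    case True
    then have q: "largest_job p \<sigma> b (r b)" using r b by blast
    note rb = largest_job_in[OF q]
    have "b \<notin> machines_A m" using b machines_AB_disjoint by blast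
    then have "jobs \<sigma>\<^sub>R b = jobs ?\<sigma> b" by (rule remove_A_schedule(2)[OF rem])
    also have "\<dots> = jobs \<sigma> b - {r b}"
    proof -
      \<comment> \<open>The jobs chosen on other machines of \<open>B\<close> lie elsewhere, so
        \<open>b\<close> loses only \<open>r b\<close>.\<close>
      have "r j = r b" if "\<sigma> (r j) = Some b" "j \<in> machines_B m \<inter> ran \<sigma>" for j
        using that r largest_job_in by fastforce
      moreover have "r b \<in> R\<^sub>B" using RBr b True by blast
      ultimately show ?thesis unfolding RBr by (auto simp: restrict_map_def)
    qed
    finally have y: "load p \<sigma>\<^sub>R b = load p \<sigma> b - p (r b)"
      using rb dom(4) by (simp add: load_def sum_diff1)
    have "LB n / 3 \<le> load p \<sigma>\<^sub>R a"
      if "a \<in> machines_A m" "LB n / 3 \<le> small_load (5/3) m p n \<sigma> a" for a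
    proof (rule remove_A_small_load[OF rem fin _ that(1)])
      show "\<forall>i\<in>dom ?\<sigma>. 0 \<le> p i" using arrival_nonneg[OF \<sigma>] by auto
      have "{i. ?\<sigma> i = Some a \<and> p i \<le> LB n / 3} = {i. \<sigma> i = Some a \<and> p i \<le> LB n / 3}"
        using jobsA[OF that(1)] by blast
      then show "LB n / 3 \<le> (\<Sum>i | ?\<sigma> i = Some a \<and> p i \<le> LB n / 3. p i)"
        using that(2) by (simp add: small_load_def small_at_5_3)
    qed
    \<comment> \<open>A remainder above \<open>2/3 * LB n\<close> has half above
      \<open>LB n / 3\<close>, a small load that survives the removal from \<open>A\<close>.\<close>
    then show ?thesis using load_B_without_largest[OF \<sigma> b q] unfolding y by force
  qed
  have "dom \<sigma>\<^sub>R \<union> R = dom ?\<sigma> \<union> R\<^sub>B" and "ran \<sigma>\<^sub>R \<subseteq> ran ?\<sigma>" using remove_A_dom[OF rem] by auto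
  moreover have "ran ?\<sigma> \<subseteq> ran \<sigma>" by (auto simp: ran_def restrict_map_def split: if_splits)
  moreover have "R\<^sub>B \<subseteq> {1..n}" using remove_B_subset[OF RB] dom(1) by simp
  ultimately have dr: "dom \<sigma>\<^sub>R \<union> set xs \<subseteq> {1..n}" "ran \<sigma>\<^sub>R \<subseteq> {1..m}" using dom(1,2) xs(2) by auto
  have dis: "dom \<sigma>\<^sub>R \<inter> set xs = {}" using remove_A_schedule(4)[OF rem] xs(2) by auto
  have "\<forall>j\<in>{1..m}. load p \<sigma>\<^sub>R j \<le> 5/3 * LB n"
    using A B L unfolding machines_AB_Un[symmetric] by fastforce
  \<comment> \<open>With \<open>g\<close> the load after removal, every machine starts in the first
    alternative.\<close>
  then have "\<forall>j\<in>{1..m}. load p \<sigma>' j \<le> 5/3 * LB n"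
    using A B by (intro reassign_load[OF re dr(1) dis dr(2) xs(1,3), of "load p \<sigma>\<^sub>R"]) auto
  then show "makespan m p \<sigma>' \<le> 5/3 * LB n"
    unfolding makespan_def using m by (subst Max_le_iff) auto
qed

end

theorem theorem4:
  fixes m :: nat
  assumes "m \<ge> 2"
  shows "competitive m (5/3) (ALG (5/3) m) \<and> migrations_at_most (4 * m) (ALG (5/3) m)"
proof -
  have "makespan m p \<sigma> \<le> 5/3 * opt m p n \<and> card R \<le> 4 * m"
    if pos: "\<forall>i\<in>{1..n}. 0 < p i" and alg: "ALG (5/3) m p n \<sigma> R" for p n \<sigma> R
  proof -
    interpret job_sequence m n p by unfold_locales (use assms pos in auto)
    have "LB n \<le> opt m p n"
      using assms pos ALG_schedule[OF alg] by (intro lower_bound_le_opt) auto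
    then show ?thesis using ALG_guarantees[OF alg] by simp
  qed
  then show ?thesis unfolding competitive_def migrations_at_most_def by blast
qed

end
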